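(* Let $\sigma\in L^1_\alpha(\mathcal X)$, $\varphi\in L^1_\alpha(\mathbb R^{d+1}_+)$ and $\psi\in L^\infty_\alpha(\mathbb R^{d+1}_+)$. Then the two-wavelet localization operator $\mathcal L_{\varphi,\psi}(\sigma)$ is a bounded linear operator from $L^\infty_\alpha(\mathbb R^{d+1}_+)$ into itself, and $$\|\mathcal L_{\varphi,\psi}(\sigma)\|_{\mathcal B(L^\infty_\alpha(\mathbb R^{d+1}_+))}\le \|\varphi\|_{\alpha,1}\,\|\psi\|_{\alpha,\infty}\,\|\sigma\|_{L^1_\alpha(\mathcal X)}.$$
   Context: Fix an integer $d\ge 1$ and a real $\alpha>-1/2$. Let $\mathbb R^{d+1}_+=\mathbb R^d\times(0,\infty)$, with points $x=(x',x_{d+1})$, equipped with the measure $$d\mu_\alpha(x)=\frac{x_{d+1}^{2\alpha+1}}{(2\pi)^d2^{2\alpha}\Gamma^2(\alpha+1)}\,dx.$$ For $1\le p\le\infty$, $L^p_\alpha(\mathbb R^{d+1}_+)$ is the $L^p$ space of complex-valued functions for $\mu_\alpha$, with norm $\|\cdot\|_{\alpha,p}$; $\mathcal B(E)$ denotes the bounded linear operators on a Banach space $E$ and $\|\cdot\|_{\mathcal B(E)}$ the operator norm. Let $\mathcal X=\{(a,x): a>0,\ x\in\mathbb R^{d+1}_+\}$ with measure $d\mu_\alpha(a,x)=\frac{d\mu_\alpha(x)\,da}{a^{2\alpha+d+3}}$, and $L^p_\alpha(\mathcal X)$ the corresponding $L^p$ space with norm $\|\cdot\|_{L^p_\alpha(\mathcal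 X)}$. Generalized translation, for $x,y\in\mathbb R^{d+1}_+$: $$\tau^\alpha_x\varphi(y)=\frac{\Gamma(\alpha+1)}{\sqrt\pi\,\Gamma(\alpha+1/2)}\int_0^\pi\varphi\Big(x'+y',\sqrt{x_{d+1}^2+y_{d+1}^2+2x_{d+1}y_{d+1}\cos\theta}\Big)(\sin\theta)^{2\alpha}\,d\theta;$$ it extends to a contraction on every $L^p_\alpha(\mathbb R^{d+1}_+)$. For $a>0$ put $\varphi_a(x)=a^{-(2\alpha+d+2)}\varphi(x/a)$ and $\varphi_{a,x}(y)=a^{\alpha+1+\frac d2}\,\tau^\alpha_x\varphi_a(y)$. Weinstein continuous wavelet transform (for $f$ and $\varphi$ in Lebesgue spaces with conjugate exponents): $$\Phi^W_\varphi(f)(a,x)=\int_{\mathbb R^{d+1}_+}f(y)\,\overline{\varphi_{a,x}(y)}\,d\mu_\alpha(y),\quad (a,x)\in\mathcal X.$$ Two-wavelet localization operator with symbol $\sigma$ (measurable on $\mathcal X$) and windows $\varphi,\psi$ (measurable on $\mathbb R^{d+1}_+$): $$\mathcal L_{\varphi,\psi}(\sigma)(f)(y)=\int_{\mathcal X}\sigma(a,x)\,\Phi^W_\varphi(f)(a,x)\,\psi_{a,x}(y)\,d\mu_\alpha(a,x),\quad y\in\mathbb R^{d+1}_+.$$ *)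

theory Defs
  imports "HOL-Probability.Probability"
begin

section \<open>Lebesgue spaces and operators on them\<close>

text \<open>
  Elements of a Lebesgue space are represented by measurable functions, equality in the space being
  equality almost everywhere.  The space of integrable functions is given by \<^const>\<open>integrable\<close>.
\<close>

definition L1_norm :: "'a measure \<Rightarrow> ('a \<Rightarrow> complex) \<Rightarrow> real" where
  "L1_norm M f = (LINT x|M. norm (f x))"

definition Linf_space :: "'a measure \<Rightarrow> ('a \<Rightarrow> complex) set" where
  "Linf_space M = {f \<in> borel_measurable M. esssup M (\<lambda>x. ennreal (norm (f x))) < \<infinity>}"

definition Linf_norm :: "'a measure \<Rightarrow> ('a \<Rightarrow> complex) \<Rightarrow> real" where
  "Linf_norm M f = enn2real (esssup M (\<lambda>x. ennreal (norm (f x))))"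

text \<open>
  The second clause says that the map descends to classes of functions modulo almost everywhere
  equality.
\<close>

definition bounded_linear_Linf ::
    "'a measure \<Rightarrow> (('a \<Rightarrow> complex) \<Rightarrow> 'a \<Rightarrow> complex) \<Rightarrow> bool" where
  "bounded_linear_Linf M T \<longleftrightarrow>
     (\<forall>f \<in> Linf_space M. T f \<in> Linf_space M) \<and>
     (\<forall>f \<in> Linf_space M. \<forall>g \<in> Linf_space M.
        (AE x in M. f x = g x) \<longrightarrow> (AE x in M. T f x = T g x)) \<and>
     (\<forall>f \<in> Linf_space M. \<forall>g \<in> Linf_space M.
        AE x in M. T (\<lambda>y. f y + g y) x = T f x + T g x) \<and>
     (\<forall>c. \<forall>f \<in> Linf_space M. AE x in M. T (\<lambda>y. c * f y) x = c * T f x) \<and>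
     (\<exists>C. \<forall>f \<in> Linf_space M. Linf_norm M (T f) \<le> C * Linf_norm M f)"

text \<open>As a real supremum, this is meaningful only for bounded operators.\<close>

definition Linf_opnorm ::
    "'a measure \<Rightarrow> (('a \<Rightarrow> complex) \<Rightarrow> 'a \<Rightarrow> complex) \<Rightarrow> real" where
  "Linf_opnorm M T = (SUP f \<in> {f \<in> Linf_space M. Linf_norm M f \<le> 1}. Linf_norm M (T f))"


section \<open>The Weinstein wavelet transform\<close>

text \<open>
  The point \<open>(x', x\<^sub>d\<^sub>+\<^sub>1)\<close> is a pair, with \<open>d = CARD('n)\<close>.  Functions on the half space are total;
  their values outside of it are irrelevant.
\<close>

type_synonym 'n point = "(real ^ 'n) \<times> real"

definition half_space :: "('n::finite) point set" where
  "half_space = {x. 0 < snd x}"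

definition weinstein_measure :: "real \<Rightarrow> ('n::finite) point measure" where
  "weinstein_measure \<alpha> =
     density (restrict_space lborel half_space)
       (\<lambda>x. ennreal (snd x powr (2 * \<alpha> + 1) /
              ((2 * pi) ^ CARD('n) * 2 powr (2 * \<alpha>) * (Gamma (\<alpha> + 1))\<^sup>2)))"

text \<open>The measure on \<open>(0, \<infinity>) \<times> half_space\<close>, whose points are the pairs \<open>(a, x)\<close>.\<close>

definition wavelet_measure :: "real \<Rightarrow> (real \<times> ('n::finite) point) measure" where
  "wavelet_measure \<alpha> =
     density (restrict_space lborel {0<..} \<Otimes>\<^sub>M weinstein_measure \<alpha>)
       (\<lambda>(a, x). ennreal (1 / a powr (2 * \<alpha> + real CARD('n) + 3)))"

text \<open>
  For \<open>\<theta>\<close> in the open interval from \<open>0\<close> to \<open>\<pi>\<close>, over which the library's interval integral is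
  taken, the argument of \<open>\<phi>\<close> lies in the half space.
\<close>

definition gen_translation ::
    "real \<Rightarrow> ('n::finite) point \<Rightarrow> ('n point \<Rightarrow> complex) \<Rightarrow> 'n point \<Rightarrow> complex" where
  "gen_translation \<alpha> x \<phi> y =
     complex_of_real (Gamma (\<alpha> + 1) / (sqrt pi * Gamma (\<alpha> + 1 / 2))) *
     (LBINT \<theta>=0..pi.
        \<phi> (fst x + fst y, sqrt ((snd x)\<^sup>2 + (snd y)\<^sup>2 + 2 * snd x * snd y * cos \<theta>)) *
        complex_of_real (sin \<theta> powr (2 * \<alpha>)))"

definition dilation ::
    "real \<Rightarrow> real \<Rightarrow> (('n::finite) point \<Rightarrow> complex) \<Rightarrow> 'n point \<Rightarrow> complex" where
  "dilation \<alpha> a \<phi> x =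
     complex_of_real (a powr (- (2 * \<alpha> + real CARD('n) + 2))) * \<phi> (x /\<^sub>R a)"

definition wavelet ::
    "real \<Rightarrow> (('n::finite) point \<Rightarrow> complex) \<Rightarrow> real \<Rightarrow> 'n point \<Rightarrow> 'n point \<Rightarrow> complex" where
  "wavelet \<alpha> \<phi> a x y =
     complex_of_real (a powr (\<alpha> + 1 + real CARD('n) / 2)) *
     gen_translation \<alpha> x (dilation \<alpha> a \<phi>) y"

definition wavelet_transform ::
    "real \<Rightarrow> (('n::finite) point \<Rightarrow> complex) \<Rightarrow> ('n point \<Rightarrow> complex) \<Rightarrow>
     real \<times> 'n point \<Rightarrow> complex" where
  "wavelet_transform \<alpha> \<phi> f =
     (\<lambda>(a, x). LINT y|weinstein_measure \<alpha>. f y * cnj (wavelet \<alpha> \<phi> a x y))"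

definition localization_op ::
    "real \<Rightarrow> (('n::finite) point \<Rightarrow> complex) \<Rightarrow> ('n point \<Rightarrow> complex) \<Rightarrow>
     (real \<times> 'n point \<Rightarrow> complex) \<Rightarrow> ('n point \<Rightarrow> complex) \<Rightarrow> 'n point \<Rightarrow> complex" where
  "localization_op \<alpha> \<phi> \<psi> \<sigma> f y =
     (LINT (a, x)|wavelet_measure \<alpha>.
        \<sigma> (a, x) * wavelet_transform \<alpha> \<phi> f (a, x) * wavelet \<alpha> \<psi> a x y)"

text \<open>
  The two Bochner integrals defining \<open>localization_op\<close> converge for \<open>f\<close> (the inner one everywhere, the
  outer one almost everywhere), so that its values are not the default \<open>0\<close> of a divergent integral.
\<close>

definition localization_op_converges ::
    "real \<Rightarrow> (('n::finite) point \<Rightarrow> complex) \<Rightarrow> ('n point \<Rightarrow> complex) \<Rightarrow>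
     (real \<times> 'n point \<Rightarrow> complex) \<Rightarrow> ('n point \<Rightarrow> complex) \<Rightarrow> bool" where
  "localization_op_converges \<alpha> \<phi> \<psi> \<sigma> f \<longleftrightarrow>
     (\<forall>a > 0. \<forall>x \<in> half_space.
        integrable (weinstein_measure \<alpha>) (\<lambda>y. f y * cnj (wavelet \<alpha> \<phi> a x y))) \<and>
     (AE y in weinstein_measure \<alpha>.
        integrable (wavelet_measure \<alpha>)
          (\<lambda>(a, x). \<sigma> (a, x) * wavelet_transform \<alpha> \<phi> f (a, x) * wavelet \<alpha> \<psi> a x y))"

end

theory Submission
  imports Defs
begin

text \<open>
  At scale \<open>a\<close> the wavelet of \<open>\<phi>\<close> has \<open>L\<^sup>1\<close> norm at most \<open>a\<^bsup>\<alpha>+1+d/2\<^esup> \<parallel>\<phi>\<parallel>\<^sub>1\<close>, and the wavelet of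
  \<open>\<psi>\<close> has \<open>L\<^sup>\<infinity>\<close> norm at most \<open>a\<^bsup>\<alpha>+1+d/2\<^esup> a\<^bsup>-(2\<alpha>+d+2)\<^esup> \<parallel>\<psi>\<parallel>\<^sub>\<infinity> = a\<^bsup>-(\<alpha>+1+d/2)\<^esup> \<parallel>\<psi>\<parallel>\<^sub>\<infinity>\<close>
  (\<open>nn_integral_wavelet_le\<close> and \<open>AE_wavelet_le\<close>).  Therefore the transform of \<open>f\<close> is at most
  \<open>\<parallel>f\<parallel>\<^sub>\<infinity> a\<^bsup>\<alpha>+1+d/2\<^esup> \<parallel>\<phi>\<parallel>\<^sub>1\<close>, the powers of \<open>a\<close> cancel in its product with the wavelet of \<open>\<psi>\<close>, and
  for each \<open>y\<close> the integrand of the localization operator is at most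
  \<open>\<parallel>\<phi>\<parallel>\<^sub>1 \<parallel>\<psi>\<parallel>\<^sub>\<infinity> \<parallel>f\<parallel>\<^sub>\<infinity> \<bar>\<sigma>(a, x)\<bar>\<close> for almost every \<open>(a, x)\<close> (\<open>AE_localization_integrand_le\<close>).  Integration
  of this bound gives convergence, the norm estimate and, with the linearity of the integral,
  the linearity of the operator.

  Both norm bounds express that the generalized translation is a contraction on \<open>L\<^sup>1\<close> and on \<open>L\<^sup>\<infinity>\<close>.
  They come from one identity for nonnegative functions, \<open>nn_integral_nn_translation\<close>: the
  translation preserves the integral.  To see why, regard the last coordinate as the distance from
  the origin in a half plane with measure \<open>v\<^bsup>2\<alpha>\<^esup> du dv\<close>.  The translation is then the mean, over a
  half circle with its probability weight proportional to \<open>(sin \<theta>)\<^bsup>2\<alpha>\<^esup>\<close>, of a horizontally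
  translated radial function, and horizontal translation preserves the measure.  Applied to a
  function that vanishes almost everywhere, the identity also shows that for almost every \<open>y\<close> the
  translation ignores the null set on which \<open>\<psi>\<close> exceeds its essential supremum.
\<close>

section \<open>Polar coordinates and the integral of powers of the sine\<close>

text \<open>
  The integration interval is open and the image is the whole line, so the substitution on compact
  intervals is applied to \<open>[arctan (- n), arctan n]\<close>, which \<open>tan\<close> maps onto \<open>[- n, n]\<close>, and the
  limit is taken by monotone convergence.
\<close>

lemma nn_integral_tan_substitution:
  fixes f :: "real \<Rightarrow> ennreal"
  assumes [measurable]: "f \<in> borel_measurable borel"
  shows "(\<integral>\<^sup>+t. f (tan t) * ennreal (1 / (cos t)\<^sup>2) * indicator {-pi/2<..<pi/2} t \<partial>lborel)
    = (\<integral>\<^sup>+u. f u \<partial>lborel)"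
proof -
  \<comment> \<open>From \<open>n = 1\<close> on the intervals are nondegenerate, as the substitution rule requires; hence the
    indices \<open>Suc n\<close> below.\<close>
  define F where "F n u = f u * indicator {- real n..real n} u" for n u
  define G where "G n t = f (tan t) * ennreal (1 / (cos t)\<^sup>2) *
    indicator {arctan (- real n)..arctan (real n)} t" for n t
  have [measurable]: "F n \<in> borel_measurable lborel" "G n \<in> borel_measurable lborel" for n
    unfolding F_def G_def tan_def by measurable
  have eq: "integral\<^sup>N lborel (F (Suc n)) = integral\<^sup>N lborel (G (Suc n))" for n
  proof -
    have in_range: "- (pi / 2) < t \<and> t < pi / 2"
      if "t \<in> {arctan (- real (Suc n))..arctan (real (Suc n))}" for t
      using that arctan_bounded[of "real (Suc n)"] arctan_bounded[of "- real (Suc n)"] by auto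
    have cos: "cos t \<noteq> 0" if "t \<in> {arctan (- real (Suc n))..arctan (real (Suc n))}" for t
      using in_range[OF that] cos_gt_zero_pi[of t] by auto
    have deriv: "(tan has_real_derivative 1 / (cos t)\<^sup>2) (at t)"
      if "t \<in> {arctan (- real (Suc n))..arctan (real (Suc n))}" for t
      using DERIV_tan[OF cos[OF that]] by (simp add: inverse_eq_divide)
    have cont: "continuous_on {arctan (- real (Suc n))..arctan (real (Suc n))} (\<lambda>t. 1 / (cos t)\<^sup>2)"
      using cos by (intro continuous_intros) auto
    have "(\<integral>\<^sup>+u. f u * indicator {tan (arctan (- real (Suc n)))..tan (arctan (real (Suc n)))} u \<partial>lborel)
      = (\<integral>\<^sup>+t. f (tan t) * ennreal (1 / (cos t)\<^sup>2) *
          indicator {arctan (- real (Suc n))..arctan (real (Suc n))} t \<partial>lborel)"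
      by (rule nn_integral_substitution_aux[OF _ _ deriv cont])
         (auto simp del: arctan_minus simp: arctan_less_iff)
    then show ?thesis
      unfolding F_def G_def tan_arctan .
  qed
  have supF: "(SUP n. F (Suc n) u) = f u" for u
  proof (rule antisym)
    show "(SUP n. F (Suc n) u) \<le> f u"
      by (intro SUP_least) (auto simp: F_def indicator_def)
    obtain m where "\<bar>u\<bar> \<le> real m" using real_arch_simple by blast
    then have "f u = F (Suc m) u" by (auto simp: F_def indicator_def)
    then show "f u \<le> (SUP n. F (Suc n) u)" by (metis SUP_upper UNIV_I)
  qed
  have supG: "(SUP n. G (Suc n) t) = f (tan t) * ennreal (1 / (cos t)\<^sup>2) * indicator {-pi/2<..<pi/2} t"
    (is "_ = ?g") for t
  proof (rule antisym)
    show "(SUP n. G (Suc n) t) \<le> ?g"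
    proof (rule SUP_least)
      fix n show "G (Suc n) t \<le> ?g"
        using arctan_bounded[of "real (Suc n)"] arctan_bounded[of "- real (Suc n)"]
        by (auto simp: G_def indicator_def simp del: arctan_minus)
    qed
    show "?g \<le> (SUP n. G (Suc n) t)"
    proof (cases "t \<in> {-pi/2<..<pi/2}")
      case True
      then have t: "arctan (tan t) = t" by (intro arctan_tan) auto
      obtain m where "\<bar>tan t\<bar> \<le> real m" using real_arch_simple by blast
      then have "arctan (- real (Suc m)) \<le> arctan (tan t)" "arctan (tan t) \<le> arctan (real (Suc m))"
        by (simp_all del: arctan_minus add: arctan_le_iff)
      then have "?g = G (Suc m) t" using True t by (auto simp: G_def)
      then show ?thesis by (metis SUP_upper UNIV_I)
    qed simp
  qed
  have incF: "incseq (\<lambda>n. F (Suc n))"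
    by (rule incseq_SucI) (auto simp: F_def le_fun_def indicator_def)
  have incG: "incseq (\<lambda>n. G (Suc n))"
  proof (rule incseq_SucI)
    fix n
    have "arctan (- real (Suc (Suc n))) \<le> arctan (- real (Suc n))"
      "arctan (real (Suc n)) \<le> arctan (real (Suc (Suc n)))"
      by (simp_all del: arctan_minus add: arctan_le_iff)
    then show "G (Suc n) \<le> G (Suc (Suc n))"
      by (auto simp: G_def le_fun_def indicator_def simp del: arctan_minus)
  qed
  have "(\<integral>\<^sup>+u. f u \<partial>lborel) = (SUP n. integral\<^sup>N lborel (F (Suc n)))"
    unfolding supF[symmetric] by (rule nn_integral_monotone_convergence_SUP[OF incF]) simp
  also have "\<dots> = (SUP n. integral\<^sup>N lborel (G (Suc n)))"
    unfolding eq ..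
  also have "\<dots> = (\<integral>\<^sup>+t. f (tan t) * ennreal (1 / (cos t)\<^sup>2) * indicator {-pi/2<..<pi/2} t \<partial>lborel)"
    unfolding supG[symmetric] by (rule nn_integral_monotone_convergence_SUP[OF incG, symmetric]) simp
  finally show ?thesis by simp
qed

lemma nn_integral_lborel_scale_halfline:
  fixes f :: "real \<Rightarrow> ennreal" and c :: real
  assumes [measurable]: "f \<in> borel_measurable borel" and c: "c > 0"
  shows "(\<integral>\<^sup>+s. f s * indicator {0<..} s \<partial>lborel)
    = (\<integral>\<^sup>+v. f (v / c) * ennreal (1 / c) * indicator {0<..} v \<partial>lborel)"
proof -
  have "(\<integral>\<^sup>+s. f s * indicator {0<..} s \<partial>lborel)
    = ennreal \<bar>1 / c\<bar> * (\<integral>\<^sup>+v. f (0 + 1 / c * v) * indicator {0<..} (0 + 1 / c * v) \<partial>lborel)"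
    by (rule nn_integral_real_affine) (use c in auto)
  also have "\<dots> = (\<integral>\<^sup>+v. f (v / c) * ennreal (1 / c) * indicator {0<..} v \<partial>lborel)"
    using c by (subst nn_integral_cmult[symmetric])
      (auto intro!: nn_integral_cong simp: indicator_def zero_less_divide_iff mult.commute)
  finally show ?thesis .
qed

text \<open>
  Two one-dimensional substitutions replace the planar change of variables.  With the angle \<open>t\<close>
  measured from the vertical axis, the point is \<open>(s sin t, s cos t)\<close>.  For fixed \<open>t\<close> the height
  \<open>v = s cos t\<close> becomes the variable, and \<open>s ds = v dv / (cos t)\<^sup>2\<close>; after exchanging the integrals,
  \<open>u = v tan t\<close> for fixed \<open>v\<close> absorbs exactly the factor \<open>v / (cos t)\<^sup>2\<close>.
\<close>

lemma nn_integral_polar_half_plane: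
  fixes H :: "real \<Rightarrow> real \<Rightarrow> ennreal"
  assumes H[measurable]: "case_prod H \<in> borel_measurable (borel \<Otimes>\<^sub>M borel)"
  shows "(\<integral>\<^sup>+s. (\<integral>\<^sup>+\<theta>. H (s * cos \<theta>) (s * sin \<theta>) * indicator {0<..<pi} \<theta> \<partial>lborel) *
              ennreal s * indicator {0<..} s \<partial>lborel)
    = (\<integral>\<^sup>+v. (\<integral>\<^sup>+u. H u v \<partial>lborel) * indicator {0<..} v \<partial>lborel)"
    (is "?lhs = ?rhs")
proof -
  have rotate: "(\<integral>\<^sup>+\<theta>. H (s * cos \<theta>) (s * sin \<theta>) * indicator {0<..<pi} \<theta> \<partial>lborel)
    = (\<integral>\<^sup>+t. H (s * sin t) (s * cos t) * indicator {-pi/2<..<pi/2} t \<partial>lborel)" for s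
    by (subst nn_integral_real_affine[where c = "-1" and t = "pi / 2"])
       (auto intro!: nn_integral_cong simp: indicator_def cos_diff sin_diff)
  have "?lhs = (\<integral>\<^sup>+s. (\<integral>\<^sup>+t. H (s * sin t) (s * cos t) * indicator {-pi/2<..<pi/2} t *
              (ennreal s * indicator {0<..} s) \<partial>lborel) \<partial>lborel)"
    unfolding rotate mult.assoc[of _ "ennreal _"]
    by (subst nn_integral_multc[symmetric]) simp_all
  also have "\<dots> = (\<integral>\<^sup>+t. (\<integral>\<^sup>+s. H (s * sin t) (s * cos t) * indicator {-pi/2<..<pi/2} t *
              (ennreal s * indicator {0<..} s) \<partial>lborel) \<partial>lborel)"
    by (rule lborel_pair.Fubini') simp
  also have "\<dots> = (\<integral>\<^sup>+t. (\<integral>\<^sup>+v. H (v * tan t) v * ennreal v * ennreal (1 / (cos t)\<^sup>2) * 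
      indicator {-pi/2<..<pi/2} t * indicator {0<..} v \<partial>lborel) \<partial>lborel)"
  proof (rule nn_integral_cong)
    fix t :: real
    show "(\<integral>\<^sup>+s. H (s * sin t) (s * cos t) * indicator {-pi/2<..<pi/2} t *
              (ennreal s * indicator {0<..} s) \<partial>lborel)
      = (\<integral>\<^sup>+v. H (v * tan t) v * ennreal v * ennreal (1 / (cos t)\<^sup>2) * 
          indicator {-pi/2<..<pi/2} t * indicator {0<..} v \<partial>lborel)"
    proof (cases "t \<in> {-pi/2<..<pi/2}")
      case True
      then have c: "cos t > 0" by (intro cos_gt_zero_pi) auto
      have "(\<integral>\<^sup>+s. (H (s * sin t) (s * cos t) * ennreal s) * indicator {0<..} s \<partial>lborel)
        = (\<integral>\<^sup>+v. (H (v / cos t * sin t) (v / cos t * cos t) * ennreal (v / cos t)) *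
             ennreal (1 / cos t) * indicator {0<..} v \<partial>lborel)"
        using c by (intro nn_integral_lborel_scale_halfline) simp_all
      also have "\<dots> = (\<integral>\<^sup>+v. H (v * tan t) v * ennreal v * ennreal (1 / (cos t)\<^sup>2) * 
           indicator {0<..} v \<partial>lborel)"
        using c by (intro nn_integral_cong)
          (auto simp: tan_def indicator_def mult.assoc power2_eq_square ennreal_mult'[symmetric])
      finally show ?thesis using True by (simp add: mult.assoc)
    qed simp
  qed
  also have "\<dots> = (\<integral>\<^sup>+v. (\<integral>\<^sup>+t. H (v * tan t) v * ennreal v * ennreal (1 / (cos t)\<^sup>2) * 
      indicator {-pi/2<..<pi/2} t * indicator {0<..} v \<partial>lborel) \<partial>lborel)"
    unfolding tan_def by (rule lborel_pair.Fubini') simp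
  also have "\<dots> = ?rhs"
  proof (rule nn_integral_cong)
    fix v :: real
    show "(\<integral>\<^sup>+t. H (v * tan t) v * ennreal v * ennreal (1 / (cos t)\<^sup>2) * 
      indicator {-pi/2<..<pi/2} t * indicator {0<..} v \<partial>lborel)
      = (\<integral>\<^sup>+u. H u v \<partial>lborel) * indicator {0<..} v"
    proof (cases "v > 0")
      case True
      have "(\<integral>\<^sup>+t. (H (v * tan t) v * ennreal v) * ennreal (1 / (cos t)\<^sup>2) * 
          indicator {-pi/2<..<pi/2} t \<partial>lborel) = (\<integral>\<^sup>+u. H (v * u) v * ennreal v \<partial>lborel)"
        by (rule nn_integral_tan_substitution[where f = "\<lambda>u. H (v * u) v * ennreal v"]) simp
      also have "\<dots> = (\<integral>\<^sup>+u. H u v \<partial>lborel)"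
        using True by (subst (2) nn_integral_real_affine[where c = v and t = 0])
          (simp_all add: nn_integral_multc mult.commute[of _ "ennreal v"] nn_integral_cmult)
      finally show ?thesis using True by simp
    qed simp
  qed
  finally show ?thesis .
qed

text \<open>
  Both halves of the interval contribute half of \<open>B (\<alpha> + 1/2, 1/2)\<close>, by \<open>t = (sin \<theta>)\<^sup>2\<close>.  Hence the
  constant in front of the generalized translation normalizes the weight \<open>(sin \<theta>)\<^bsup>2\<alpha>\<^esup>\<close> to a
  probability density, which is where \<open>\<alpha> > - 1/2\<close> enters.
\<close>

lemma nn_integral_sin_powr:
  fixes \<alpha> :: real
  assumes \<alpha>: "\<alpha> > - 1 / 2"
  shows "(\<integral>\<^sup>+\<theta>. ennreal (sin \<theta> powr (2 * \<alpha>)) * indicator {0<..<pi} \<theta> \<partial>lborel)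
    = ennreal (sqrt pi * Gamma (\<alpha> + 1 / 2) / Gamma (\<alpha> + 1))"
proof -
  define h :: "real \<Rightarrow> ennreal"
    where "h t = ennreal (t powr (\<alpha> - 1 / 2) * (1 - t) powr (- 1 / 2))" for t
  have [measurable]: "h \<in> borel_measurable borel" unfolding h_def by measurable
  have beta: "(\<integral>\<^sup>+t. h t * indicator {0..1} t \<partial>lborel) = ennreal (Beta (\<alpha> + 1 / 2) (1 / 2))"
    using has_integral_Beta_real[of "\<alpha> + 1 / 2" "1 / 2"] \<alpha> unfolding h_def
    by (intro nn_integral_has_integral_lebesgue') auto
  have point: "h (x\<^sup>2) * ennreal (2 * x * y) = 2 * ennreal (x powr (2 * \<alpha>))"
    if "x > 0" "y > 0" and xy: "x\<^sup>2 + y\<^sup>2 = 1" for x y :: real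
  proof -
    have "x\<^sup>2 powr (\<alpha> - 1 / 2) = (x powr 2) powr (\<alpha> - 1 / 2)" using that by simp
    also have "\<dots> = x powr (2 * \<alpha> - 1)" by (simp only: powr_powr) (simp add: algebra_simps)
    finally have x: "x\<^sup>2 powr (\<alpha> - 1 / 2) = x powr (2 * \<alpha> - 1)" .
    have "1 - x\<^sup>2 = y powr 2" using xy that by simp
    then have "(1 - x\<^sup>2) powr (- 1 / 2) = (y powr 2) powr (- 1 / 2)" by (simp only:)
    also have "\<dots> = 1 / y" using that by (simp only: powr_powr) (simp add: powr_minus_divide)
    finally have "x\<^sup>2 powr (\<alpha> - 1 / 2) * (1 - x\<^sup>2) powr (- 1 / 2) * (2 * x * y)
      = 2 * (x powr (2 * \<alpha> - 1) * x powr 1)"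
      using that x by simp
    also have "\<dots> = 2 * x powr (2 * \<alpha>)" by (simp only: powr_add[symmetric]) simp
    finally show ?thesis
      using that by (simp add: h_def ennreal_mult'[symmetric] ennreal_mult''[symmetric] flip: ennreal_numeral)
  qed
  have sin_half: "(\<integral>\<^sup>+\<theta>. 2 * ennreal (sin \<theta> powr (2 * \<alpha>)) * indicator {0..pi/2} \<theta> \<partial>lborel)
     = (\<integral>\<^sup>+t. h t * indicator {0..1} t \<partial>lborel)"
  proof -
    have "(\<integral>\<^sup>+t. h t * indicator {(sin 0)\<^sup>2..(sin (pi / 2))\<^sup>2} t \<partial>lborel)
      = (\<integral>\<^sup>+\<theta>. h ((sin \<theta>)\<^sup>2) * ennreal (2 * sin \<theta> * cos \<theta>) * indicator {0..pi / 2} \<theta> \<partial>lborel)"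
      by (rule nn_integral_substitution_aux)
         (auto intro!: derivative_eq_intros continuous_intros mult_nonneg_nonneg
           sin_ge_zero cos_ge_zero)
    \<comment> \<open>At \<open>\<pi> / 2\<close> the derivative of \<open>(sin \<theta>)\<^sup>2\<close> vanishes and the integrands differ.\<close>
    also have "\<dots> = (\<integral>\<^sup>+\<theta>. 2 * ennreal (sin \<theta> powr (2 * \<alpha>)) * indicator {0..pi/2} \<theta> \<partial>lborel)"
    proof (rule nn_integral_cong_AE)
      show "AE \<theta> in lborel. h ((sin \<theta>)\<^sup>2) * ennreal (2 * sin \<theta> * cos \<theta>) * indicator {0..pi / 2} \<theta>
        = 2 * ennreal (sin \<theta> powr (2 * \<alpha>)) * indicator {0..pi/2} \<theta>"
        using AE_lborel_singleton[of 0] AE_lborel_singleton[of "pi / 2"]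
      proof eventually_elim
        case (elim \<theta>)
        show ?case
        proof (cases "\<theta> \<in> {0..pi/2}")
          case True
          with elim have "sin \<theta> > 0" "cos \<theta> > 0"
            by (auto intro!: sin_gt_zero cos_gt_zero)
          then show ?thesis by (simp add: point)
        qed simp
      qed
    qed
    finally show ?thesis by simp
  qed
  have cos_half: "(\<integral>\<^sup>+\<theta>. 2 * ennreal (sin \<theta> powr (2 * \<alpha>)) * indicator {pi/2..pi} \<theta> \<partial>lborel)
     = (\<integral>\<^sup>+\<theta>. 2 * ennreal (sin \<theta> powr (2 * \<alpha>)) * indicator {0..pi/2} \<theta> \<partial>lborel)"
    by (subst nn_integral_real_affine[where c = "-1" and t = pi])
       (auto intro!: nn_integral_cong simp: indicator_def)
  have "2 * (\<integral>\<^sup>+\<theta>. ennreal (sin \<theta> powr (2 * \<alpha>)) * indicator {0<..<pi} \<theta> \<partial>lborel)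
    = (\<integral>\<^sup>+\<theta>. 2 * ennreal (sin \<theta> powr (2 * \<alpha>)) * indicator {0<..<pi} \<theta> \<partial>lborel)"
    by (subst nn_integral_cmult[symmetric]) (simp_all add: mult.assoc)
  also have "\<dots> = (\<integral>\<^sup>+\<theta>. 2 * ennreal (sin \<theta> powr (2 * \<alpha>)) * indicator {0..pi/2} \<theta> +
      2 * ennreal (sin \<theta> powr (2 * \<alpha>)) * indicator {pi/2..pi} \<theta> \<partial>lborel)"
  proof (rule nn_integral_cong_AE)
    show "AE \<theta> in lborel. 2 * ennreal (sin \<theta> powr (2 * \<alpha>)) * indicator {0<..<pi} \<theta>
      = 2 * ennreal (sin \<theta> powr (2 * \<alpha>)) * indicator {0..pi/2} \<theta> +
        2 * ennreal (sin \<theta> powr (2 * \<alpha>)) * indicator {pi/2..pi} \<theta>"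
      using AE_lborel_singleton[of 0] AE_lborel_singleton[of "pi / 2"] AE_lborel_singleton[of pi]
      by eventually_elim (auto simp: indicator_def)
  qed
  also have "\<dots> = ennreal (Beta (\<alpha> + 1 / 2) (1 / 2)) + ennreal (Beta (\<alpha> + 1 / 2) (1 / 2))"
    unfolding beta[symmetric] by (subst nn_integral_add) (simp_all add: cos_half sin_half)
  also have "\<dots> = 2 * ennreal (Beta (\<alpha> + 1 / 2) (1 / 2))"
    by (rule mult_2[symmetric])
  finally have "(\<integral>\<^sup>+\<theta>. ennreal (sin \<theta> powr (2 * \<alpha>)) * indicator {0<..<pi} \<theta> \<partial>lborel)
    = ennreal (Beta (\<alpha> + 1 / 2) (1 / 2))"
    by (simp add: ennreal_mult_cancel_left)
  also have "Beta (\<alpha> + 1 / 2) (1 / 2) = sqrt pi * Gamma (\<alpha> + 1 / 2) / Gamma (\<alpha> + 1)"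
    by (simp add: Beta_def Gamma_one_half_real add.commute)
  finally show ?thesis .
qed

text \<open>
  This is the one-variable core of the contraction property of the generalized translation.  The
  radicand is the squared norm of the planar point \<open>(x + s cos \<theta>, s sin \<theta>)\<close>, and
  \<open>s\<^bsup>2\<alpha>+1\<^esup> (sin \<theta>)\<^bsup>2\<alpha>\<^esup> ds d\<theta> = v\<^bsup>2\<alpha>\<^esup> du dv\<close> in the Cartesian coordinates \<open>u = s cos \<theta>\<close>,
  \<open>v = s sin \<theta>\<close>.  This measure is invariant under horizontal translation, so the left-hand side does
  not depend on \<open>x\<close>, and for \<open>x = 0\<close> the integrals over \<open>s\<close> and \<open>\<theta>\<close> separate.
\<close>

lemma nn_integral_translated_radius:
  fixes h :: "real \<Rightarrow> ennreal" and x \<alpha> :: real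
  assumes h[measurable]: "h \<in> borel_measurable borel" and \<alpha>: "\<alpha> > - 1 / 2"
  shows "(\<integral>\<^sup>+s. (\<integral>\<^sup>+\<theta>. h (sqrt (x\<^sup>2 + s\<^sup>2 + 2 * x * s * cos \<theta>)) * ennreal (sin \<theta> powr (2 * \<alpha>)) *
              indicator {0<..<pi} \<theta> \<partial>lborel) * ennreal (s powr (2 * \<alpha> + 1)) * indicator {0<..} s \<partial>lborel)
    = ennreal (sqrt pi * Gamma (\<alpha> + 1 / 2) / Gamma (\<alpha> + 1)) *
        (\<integral>\<^sup>+r. h r * ennreal (r powr (2 * \<alpha> + 1)) * indicator {0<..} r \<partial>lborel)"
    (is "?L x = _")
proof -
  define H where "H b u v = h (sqrt ((b + u)\<^sup>2 + v\<^sup>2)) * ennreal (v powr (2 * \<alpha>))" for b u v :: real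
  have [measurable]: "case_prod (H b) \<in> borel_measurable (borel \<Otimes>\<^sub>M borel)" for b
    unfolding H_def by measurable
  have shift: "(\<integral>\<^sup>+u. H b u v \<partial>lborel) = (\<integral>\<^sup>+u. H 0 u v \<partial>lborel)" for b v
  proof -
    have [measurable]: "(\<lambda>u. H 0 u v) \<in> borel_measurable borel" unfolding H_def by measurable
    show ?thesis using nn_integral_real_affine[of "\<lambda>u. H 0 u v" 1 b] by (simp add: H_def)
  qed
  have L: "?L b = (\<integral>\<^sup>+v. (\<integral>\<^sup>+u. H 0 u v \<partial>lborel) * indicator {0<..} v \<partial>lborel)" for b
  proof -
    have "?L b = (\<integral>\<^sup>+s. (\<integral>\<^sup>+\<theta>. H b (s * cos \<theta>) (s * sin \<theta>) * indicator {0<..<pi} \<theta> \<partial>lborel) *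
              ennreal s * indicator {0<..} s \<partial>lborel)"
    proof (rule nn_integral_cong)
      fix s :: real
      show "(\<integral>\<^sup>+\<theta>. h (sqrt (b\<^sup>2 + s\<^sup>2 + 2 * b * s * cos \<theta>)) * ennreal (sin \<theta> powr (2 * \<alpha>)) *
              indicator {0<..<pi} \<theta> \<partial>lborel) * ennreal (s powr (2 * \<alpha> + 1)) * indicator {0<..} s
         = (\<integral>\<^sup>+\<theta>. H b (s * cos \<theta>) (s * sin \<theta>) * indicator {0<..<pi} \<theta> \<partial>lborel) *
              ennreal s * indicator {0<..} s"
      proof (cases "s > 0")
        case True
        have polar: "(b + s * cos \<theta>)\<^sup>2 + (s * sin \<theta>)\<^sup>2 = b\<^sup>2 + s\<^sup>2 + 2 * b * s * cos \<theta>" for \<theta>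
        proof -
          have "(b + s * p)\<^sup>2 + (s * q)\<^sup>2 = b\<^sup>2 + s\<^sup>2 * (q\<^sup>2 + p\<^sup>2) + 2 * b * s * p" for p q
            by (simp add: power2_eq_square algebra_simps)
          from this[of "cos \<theta>" "sin \<theta>"] show ?thesis by simp
        qed
        have weight: "ennreal (sin \<theta> powr (2 * \<alpha>)) * ennreal (s powr (2 * \<alpha> + 1))
          = ennreal ((s * sin \<theta>) powr (2 * \<alpha>)) * ennreal s" if "\<theta> \<in> {0<..<pi}" for \<theta>
        proof -
          have "sin \<theta> > 0" using that by (auto intro: sin_gt_zero)
          then show ?thesis
            using True by (simp add: ennreal_mult''[symmetric] powr_mult powr_add mult_ac)
        qed
        show ?thesis
          using True weight unfolding H_def polar
          by (subst (1 2) nn_integral_multc[symmetric])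
             (auto intro!: nn_integral_cong simp: indicator_def mult.assoc)
      qed simp
    qed
    also have "\<dots> = (\<integral>\<^sup>+v. (\<integral>\<^sup>+u. H b u v \<partial>lborel) * indicator {0<..} v \<partial>lborel)"
      by (rule nn_integral_polar_half_plane) measurable
    finally show ?thesis unfolding shift[of b] .
  qed
  have "?L x = ?L 0" unfolding L ..
  also have "\<dots> = (\<integral>\<^sup>+s. ennreal (sqrt pi * Gamma (\<alpha> + 1 / 2) / Gamma (\<alpha> + 1)) *
        (h s * ennreal (s powr (2 * \<alpha> + 1)) * indicator {0<..} s) \<partial>lborel)"
  proof (rule nn_integral_cong)
    fix s :: real
    have "(\<integral>\<^sup>+\<theta>. h s * ennreal (sin \<theta> powr (2 * \<alpha>)) * indicator {0<..<pi} \<theta> \<partial>lborel)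
      = h s * ennreal (sqrt pi * Gamma (\<alpha> + 1 / 2) / Gamma (\<alpha> + 1))"
      unfolding nn_integral_sin_powr[OF \<alpha>, symmetric] mult.assoc
      by (rule nn_integral_cmult) measurable
    then show "(\<integral>\<^sup>+\<theta>. h (sqrt (0\<^sup>2 + s\<^sup>2 + 2 * 0 * s * cos \<theta>)) * ennreal (sin \<theta> powr (2 * \<alpha>)) *
        indicator {0<..<pi} \<theta> \<partial>lborel) * ennreal (s powr (2 * \<alpha> + 1)) * indicator {0<..} s
      = ennreal (sqrt pi * Gamma (\<alpha> + 1 / 2) / Gamma (\<alpha> + 1)) *
          (h s * ennreal (s powr (2 * \<alpha> + 1)) * indicator {0<..} s)"
      by (cases "s > 0") (simp_all add: mult_ac)
  qed
  also have "\<dots> = ennreal (sqrt pi * Gamma (\<alpha> + 1 / 2) / Gamma (\<alpha> + 1)) *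
        (\<integral>\<^sup>+r. h r * ennreal (r powr (2 * \<alpha> + 1)) * indicator {0<..} r \<partial>lborel)"
    by (rule nn_integral_cmult) measurable
  finally show ?thesis .
qed

section \<open>The Weinstein measure\<close>

text \<open>
  Points carry the Borel algebra of the product topology rather than the product of the Borel
  algebras of the factors; the continuity of the projections makes them measurable for it.
\<close>

lemma borel_measurable_fst_snd [measurable (raw)]:
  fixes f :: "'a \<Rightarrow> 'b::topological_space \<times> 'c::topological_space"
  assumes "f \<in> borel_measurable M"
  shows "(\<lambda>x. fst (f x)) \<in> borel_measurable M" "(\<lambda>x. snd (f x)) \<in> borel_measurable M"
  using borel_measurable_continuous_on[OF _ assms, of fst]
    borel_measurable_continuous_on[OF _ assms, of snd]
  by (simp_all add: continuous_on_fst continuous_on_snd)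

lemma half_space_borel [measurable]: "half_space \<in> sets (borel :: ('n::finite) point measure)"
proof -
  have "half_space = {x :: 'n point. 0 < snd x}" by (simp add: half_space_def)
  also have "\<dots> \<in> sets borel" by measurable
  finally show ?thesis .
qed

lemma sets_weinstein_measure [measurable_cong]:
  "sets (weinstein_measure \<alpha> :: ('n::finite) point measure) = sets (restrict_space borel half_space)"
  by (simp add: weinstein_measure_def cong: sets_restrict_space_cong)

lemma space_weinstein_measure [simp]:
  "space (weinstein_measure \<alpha> :: ('n::finite) point measure) = half_space"
  by (simp add: weinstein_measure_def space_restrict_space)

lemma nn_integral_weinstein_measure:
  fixes g :: "('n::finite) point \<Rightarrow> ennreal"
  assumes [measurable]: "g \<in> borel_measurable borel"
  shows "(\<integral>\<^sup>+y. g y \<partial>weinstein_measure \<alpha>)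
    = (\<integral>\<^sup>+y. g y * ennreal (snd y powr (2 * \<alpha> + 1) /
        ((2 * pi) ^ CARD('n) * 2 powr (2 * \<alpha>) * (Gamma (\<alpha> + 1))\<^sup>2)) * indicator half_space y \<partial>lborel)"
proof -
  have [measurable]: "g \<in> borel_measurable (restrict_space lborel half_space)"
    by (rule measurable_restrict_space1) simp
  have [measurable]: "(snd :: 'n point \<Rightarrow> real) \<in> borel_measurable (restrict_space lborel half_space)"
    by (rule measurable_restrict_space1) simp
  show ?thesis
    unfolding weinstein_measure_def
    by (simp add: nn_integral_density nn_integral_restrict_space mult_ac)
qed

lemma nn_integral_weinstein_measure_product:
  fixes g :: "('n::finite) point \<Rightarrow> ennreal"
  assumes [measurable]: "g \<in> borel_measurable borel"
  shows "(\<integral>\<^sup>+y. g y \<partial>weinstein_measure \<alpha>)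
    = ennreal (1 / ((2 * pi) ^ CARD('n) * 2 powr (2 * \<alpha>) * (Gamma (\<alpha> + 1))\<^sup>2)) *
      (\<integral>\<^sup>+v. (\<integral>\<^sup>+s. g (v, s) * ennreal (s powr (2 * \<alpha> + 1)) * indicator {0<..} s \<partial>lborel) \<partial>lborel)"
    (is "_ = ennreal ?K * _")
proof -
  have K: "?K \<ge> 0" by simp
  have "(\<integral>\<^sup>+y. g y \<partial>weinstein_measure \<alpha>)
    = (\<integral>\<^sup>+y. ennreal ?K * (g y * ennreal (snd y powr (2 * \<alpha> + 1)) * indicator {0<..} (snd y)) \<partial>lborel)"
    unfolding nn_integral_weinstein_measure[OF assms]
  proof (rule nn_integral_cong)
    fix y :: "'n point"
    have "ennreal (snd y powr (2 * \<alpha> + 1) / ((2 * pi) ^ CARD('n) * 2 powr (2 * \<alpha>) * (Gamma (\<alpha> + 1))\<^sup>2))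
      = ennreal ?K * ennreal (snd y powr (2 * \<alpha> + 1))"
      using K by (subst ennreal_mult'[symmetric]) simp_all
    then show "g y * ennreal (snd y powr (2 * \<alpha> + 1) /
        ((2 * pi) ^ CARD('n) * 2 powr (2 * \<alpha>) * (Gamma (\<alpha> + 1))\<^sup>2)) * indicator half_space y
      = ennreal ?K * (g y * ennreal (snd y powr (2 * \<alpha> + 1)) * indicator {0<..} (snd y))"
      by (simp only: half_space_def indicator_def) (simp add: mult_ac)
  qed
  also have "\<dots> = ennreal ?K * (\<integral>\<^sup>+y. g y * ennreal (snd y powr (2 * \<alpha> + 1)) * indicator {0<..} (snd y) \<partial>lborel)"
    by (rule nn_integral_cmult) measurable
  also have "(\<integral>\<^sup>+y. g y * ennreal (snd y powr (2 * \<alpha> + 1)) * indicator {0<..} (snd y) \<partial>lborel)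
    = (\<integral>\<^sup>+y. g y * ennreal (snd y powr (2 * \<alpha> + 1)) * indicator {0<..} (snd y)
        \<partial>(lborel \<Otimes>\<^sub>M lborel))"
    by (simp only: lborel_prod)
  also have "\<dots> = (\<integral>\<^sup>+v. (\<integral>\<^sup>+s. g (v, s) * ennreal (s powr (2 * \<alpha> + 1)) * indicator {0<..} s \<partial>lborel) \<partial>lborel)"
    by (subst lborel.nn_integral_fst[symmetric]) (simp_all add: lborel_prod)
  finally show ?thesis .
qed

text \<open>
  The density is homogeneous of degree \<open>2\<alpha> + 1\<close> and the dimension is \<open>d + 1\<close>.
\<close>

lemma nn_integral_weinstein_measure_dilation:
  fixes g :: "('n::finite) point \<Rightarrow> ennreal"
  assumes g[measurable]: "g \<in> borel_measurable borel" and a: "a > 0"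
  shows "(\<integral>\<^sup>+y. g (y /\<^sub>R a) \<partial>weinstein_measure \<alpha>)
    = ennreal (a powr (2 * \<alpha> + real CARD('n) + 2)) * (\<integral>\<^sup>+y. g y \<partial>weinstein_measure \<alpha>)"
proof -
  define w where "w y = ennreal (snd y powr (2 * \<alpha> + 1) /
        ((2 * pi) ^ CARD('n) * 2 powr (2 * \<alpha>) * (Gamma (\<alpha> + 1))\<^sup>2)) * indicator half_space y"
    for y :: "'n point"
  have [measurable]: "w \<in> borel_measurable borel" unfolding w_def by measurable
  have w: "w (a *\<^sub>R y) = ennreal (a powr (2 * \<alpha> + 1)) * w y" for y
    using a by (auto simp: w_def half_space_def indicator_def zero_less_mult_iff powr_mult
        ennreal_mult'[symmetric])
  have "(\<integral>\<^sup>+y. g (y /\<^sub>R a) \<partial>weinstein_measure \<alpha>) = (\<integral>\<^sup>+y. g (y /\<^sub>R a) * w y \<partial>lborel)"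
    unfolding w_def by (subst nn_integral_weinstein_measure) (simp_all add: mult.assoc)
  also have "\<dots> = (\<integral>\<^sup>+y. ennreal (\<bar>a\<bar> ^ DIM('n point)) * (g y * w (a *\<^sub>R y)) \<partial>lborel)"
    using a by (subst lborel_affine[of a 0]) (simp_all add: nn_integral_density nn_integral_distr)
  also have "\<dots> = (\<integral>\<^sup>+y. ennreal (a powr (2 * \<alpha> + real CARD('n) + 2)) * (g y * w y) \<partial>lborel)"
  proof (rule nn_integral_cong)
    fix y :: "'n point"
    have "\<bar>a\<bar> ^ DIM('n point) = a powr (real CARD('n) + 1)"
      using a by (simp add: powr_add powr_realpow)
    then have "ennreal (\<bar>a\<bar> ^ DIM('n point)) * ennreal (a powr (2 * \<alpha> + 1))
      = ennreal (a powr (2 * \<alpha> + real CARD('n) + 2))"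
      by (simp add: ennreal_mult'[symmetric] powr_add[symmetric] add_ac)
    then show "ennreal (\<bar>a\<bar> ^ DIM('n point)) * (g y * w (a *\<^sub>R y))
      = ennreal (a powr (2 * \<alpha> + real CARD('n) + 2)) * (g y * w y)"
      unfolding w by (metis mult.assoc mult.left_commute)
  qed
  also have "\<dots> = ennreal (a powr (2 * \<alpha> + real CARD('n) + 2)) * (\<integral>\<^sup>+y. g y * w y \<partial>lborel)"
    by (rule nn_integral_cmult) measurable
  also have "(\<integral>\<^sup>+y. g y * w y \<partial>lborel) = (\<integral>\<^sup>+y. g y \<partial>weinstein_measure \<alpha>)"
    unfolding w_def by (simp add: nn_integral_weinstein_measure mult.assoc)
  finally show ?thesis .
qed

section \<open>The generalized translation of nonnegative functions\<close>

text \<open>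
  For nonnegative functions with values in \<open>[0, \<infinity>]\<close> no convergence questions arise; the complex
  generalized translation is dominated by this one applied to the norm.
\<close>

definition nn_translation ::
    "real \<Rightarrow> ('n::finite) point \<Rightarrow> ('n point \<Rightarrow> ennreal) \<Rightarrow> 'n point \<Rightarrow> ennreal" where
  "nn_translation \<alpha> x g y = ennreal (Gamma (\<alpha> + 1) / (sqrt pi * Gamma (\<alpha> + 1 / 2))) *
     (\<integral>\<^sup>+\<theta>. g (fst x + fst y, sqrt ((snd x)\<^sup>2 + (snd y)\<^sup>2 + 2 * snd x * snd y * cos \<theta>)) *
        ennreal (sin \<theta> powr (2 * \<alpha>)) * indicator {0<..<pi} \<theta> \<partial>lborel)"

lemma nn_translation_measurable [measurable]:
  assumes [measurable]: "g \<in> borel_measurable borel"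
  shows "nn_translation \<alpha> x g \<in> borel_measurable borel"
  unfolding nn_translation_def by measurable

lemma translation_constant_inverse:
  assumes "\<alpha> > - 1 / 2"
  shows "ennreal (Gamma (\<alpha> + 1) / (sqrt pi * Gamma (\<alpha> + 1 / 2))) *
    ennreal (sqrt pi * Gamma (\<alpha> + 1 / 2) / Gamma (\<alpha> + 1)) = 1"
proof -
  have "Gamma (\<alpha> + 1) > 0" "Gamma (\<alpha> + 1 / 2) > 0" using assms by (auto intro!: Gamma_real_pos)
  then show ?thesis by (simp add: ennreal_mult''[symmetric])
qed

lemma nn_translation_const:
  assumes "\<alpha> > - 1 / 2"
  shows "nn_translation \<alpha> x (\<lambda>_. c) y = c"
proof -
  have "(\<integral>\<^sup>+\<theta>. c * ennreal (sin \<theta> powr (2 * \<alpha>)) * indicator {0<..<pi} \<theta> \<partial>lborel)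
      = c * ennreal (sqrt pi * Gamma (\<alpha> + 1 / 2) / Gamma (\<alpha> + 1))"
    unfolding nn_integral_sin_powr[OF assms, symmetric] mult.assoc
    by (rule nn_integral_cmult) measurable
  then show ?thesis
    unfolding nn_translation_def
    using translation_constant_inverse[OF assms] by (metis mult.commute mult.left_commute mult_1_right)
qed

text \<open>
  The generalized translation preserves the integral of a nonnegative function.  In particular it is
  a contraction on the integrable functions, and it maps null sets to null sets, which gives the
  contraction property on essentially bounded functions.  For fixed first \<open>d\<close> coordinates the claim
  is \<open>nn_integral_translated_radius\<close>; the shift of those coordinates is absorbed by the invariance of
  Lebesgue measure.
\<close>

lemma nn_integral_nn_translation:
  fixes g :: "('n::finite) point \<Rightarrow> ennreal"
  assumes \<alpha>: "\<alpha> > - 1 / 2" and g[measurable]: "g \<in> borel_measurable borel"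
  shows "(\<integral>\<^sup>+y. nn_translation \<alpha> x g y \<partial>weinstein_measure \<alpha>) = (\<integral>\<^sup>+y. g y \<partial>weinstein_measure \<alpha>)"
proof -
  define c where "c = ennreal (Gamma (\<alpha> + 1) / (sqrt pi * Gamma (\<alpha> + 1 / 2)))"
  define G where "G v s = (\<integral>\<^sup>+\<theta>. g (fst x + v, sqrt ((snd x)\<^sup>2 + s\<^sup>2 + 2 * snd x * s * cos \<theta>)) *
        ennreal (sin \<theta> powr (2 * \<alpha>)) * indicator {0<..<pi} \<theta> \<partial>lborel)" for v s
  define R where "R v = (\<integral>\<^sup>+s. g (v, s) * ennreal (s powr (2 * \<alpha> + 1)) * indicator {0<..} s \<partial>lborel)" for v
  have [measurable]: "G v \<in> borel_measurable borel" for v unfolding G_def by measurable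
  have [measurable]: "R \<in> borel_measurable borel" unfolding R_def by measurable
  have inner: "(\<integral>\<^sup>+s. nn_translation \<alpha> x g (v, s) * ennreal (s powr (2 * \<alpha> + 1)) * indicator {0<..} s \<partial>lborel)
    = R (fst x + v)" for v
  proof -
    have "(\<integral>\<^sup>+s. nn_translation \<alpha> x g (v, s) * ennreal (s powr (2 * \<alpha> + 1)) * indicator {0<..} s \<partial>lborel)
      = (\<integral>\<^sup>+s. c * (G v s * ennreal (s powr (2 * \<alpha> + 1)) * indicator {0<..} s) \<partial>lborel)"
      by (simp add: nn_translation_def c_def G_def mult.assoc)
    also have "\<dots> = c * (\<integral>\<^sup>+s. G v s * ennreal (s powr (2 * \<alpha> + 1)) * indicator {0<..} s \<partial>lborel)"
      by (rule nn_integral_cmult) measurable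
    also have "\<dots> = c * (ennreal (sqrt pi * Gamma (\<alpha> + 1 / 2) / Gamma (\<alpha> + 1)) * R (fst x + v))"
      unfolding G_def R_def
      by (subst nn_integral_translated_radius[OF _ \<alpha>, where h = "\<lambda>r. g (fst x + v, r)"]) simp_all
    also have "\<dots> = R (fst x + v)"
      unfolding c_def mult.assoc[symmetric] translation_constant_inverse[OF \<alpha>] by simp
    finally show ?thesis .
  qed
  have "(\<integral>\<^sup>+v. R (fst x + v) \<partial>lborel) = (\<integral>\<^sup>+v. R v \<partial>distr lborel borel ((+) (fst x)))"
    by (subst nn_integral_distr) simp_all
  also have "\<dots> = (\<integral>\<^sup>+v. R v \<partial>lborel)"
    by (simp add: lborel_distr_plus)
  finally show ?thesis
    by (simp add: nn_integral_weinstein_measure_product inner R_def)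
qed

lemma nn_translation_mono:
  assumes "\<And>z. g z \<le> h z"
  shows "nn_translation \<alpha> x g y \<le> nn_translation \<alpha> x h y"
  unfolding nn_translation_def
  by (intro mult_left_mono nn_integral_mono mult_right_mono assms) auto

lemma nn_translation_add:
  assumes [measurable]: "g \<in> borel_measurable borel" "h \<in> borel_measurable borel"
  shows "nn_translation \<alpha> x (\<lambda>z. g z + h z) y = nn_translation \<alpha> x g y + nn_translation \<alpha> x h y"
  unfolding nn_translation_def distrib_right distrib_left[symmetric]
  by (subst nn_integral_add) simp_all

text \<open>
  A divergent Bochner integral has the value \<open>0\<close>, so the bound also covers the points at which the
  integral defining the generalized translation diverges.
\<close>

lemma norm_integral_le_nn_integral:
  fixes f :: "'a \<Rightarrow> 'b::{banach, second_countable_topology}"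
  shows "ennreal (norm (integral\<^sup>L M f)) \<le> (\<integral>\<^sup>+x. ennreal (norm (f x)) \<partial>M)"
proof (cases "integrable M f")
  case True
  then show ?thesis by (rule integral_norm_bound_ennreal)
qed (simp add: not_integrable_integral_eq)

lemma gen_translation_norm_le:
  assumes "\<alpha> > - 1 / 2"
  shows "ennreal (norm (gen_translation \<alpha> x \<phi> y)) \<le> nn_translation \<alpha> x (\<lambda>z. ennreal (norm (\<phi> z))) y"
proof -
  have c: "Gamma (\<alpha> + 1) / (sqrt pi * Gamma (\<alpha> + 1 / 2)) \<ge> 0"
    using assms by (intro divide_nonneg_nonneg mult_nonneg_nonneg less_imp_le[OF Gamma_real_pos]) auto
  have "ennreal (norm (gen_translation \<alpha> x \<phi> y)) = ennreal (Gamma (\<alpha> + 1) / (sqrt pi * Gamma (\<alpha> + 1 / 2))) *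
     ennreal (norm (LINT \<theta>|lborel. indicator {0<..<pi} \<theta> *\<^sub>R
        (\<phi> (fst x + fst y, sqrt ((snd x)\<^sup>2 + (snd y)\<^sup>2 + 2 * snd x * snd y * cos \<theta>)) *
        complex_of_real (sin \<theta> powr (2 * \<alpha>)))))"
    unfolding gen_translation_def norm_mult norm_of_real abs_of_nonneg[OF c] ennreal_mult'[OF c]
    by (simp add: interval_lebesgue_integral_def set_lebesgue_integral_def zero_ereal_def)
  also have "\<dots> \<le> nn_translation \<alpha> x (\<lambda>z. ennreal (norm (\<phi> z))) y"
    unfolding nn_translation_def
    by (intro mult_left_mono order_trans[OF norm_integral_le_nn_integral] nn_integral_mono)
       (auto simp: indicator_def norm_mult ennreal_mult')
  finally show ?thesis .
qed

section \<open>Wavelets\<close>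

text \<open>
  For \<open>\<theta> < \<pi>\<close> the radicand is \<open>(x - y)\<^sup>2 + 2 x y (1 + cos \<theta>) > 0\<close>, so the function is evaluated at
  points of the half space only.
\<close>

lemma gen_translation_cong_half_space:
  assumes eq: "\<And>z. z \<in> half_space \<Longrightarrow> \<phi> z = \<psi> z" and x: "x \<in> half_space" and y: "y \<in> half_space"
  shows "gen_translation \<alpha> x \<phi> y = gen_translation \<alpha> x \<psi> y"
proof -
  have "(snd x)\<^sup>2 + (snd y)\<^sup>2 + 2 * snd x * snd y * cos \<theta> > 0" if \<theta>: "\<theta> \<in> {0<..<pi}" for \<theta>
  proof -
    have "cos pi < cos \<theta>" using \<theta> by (intro cos_monotone_0_pi) auto
    then have "snd x * snd y * (1 + cos \<theta>) > 0"
      using x y by (intro mult_pos_pos) (auto simp: half_space_def)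
    moreover have "(snd x)\<^sup>2 + (snd y)\<^sup>2 + 2 * snd x * snd y * cos \<theta>
      = (snd x - snd y)\<^sup>2 + 2 * (snd x * snd y * (1 + cos \<theta>))"
      by (simp add: power2_eq_square algebra_simps)
    ultimately show ?thesis by (simp add: add_nonneg_pos)
  qed
  then show ?thesis
    unfolding gen_translation_def zero_ereal_def
    by (intro arg_cong2[where f = "(*)"] refl interval_integral_cong)
       (auto simp: half_space_def min_def max_def intro!: eq)
qed

lemma wavelet_cong_half_space:
  assumes "\<And>z. z \<in> half_space \<Longrightarrow> \<phi> z = \<psi> z" and "x \<in> half_space" "y \<in> half_space" and "a > 0"
  shows "wavelet \<alpha> \<phi> a x y = wavelet \<alpha> \<psi> a x y"
  unfolding wavelet_def using assms
  by (subst gen_translation_cong_half_space[where \<psi> = "dilation \<alpha> a \<psi>"])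
     (auto simp: dilation_def half_space_def)

lemma wavelet_commute: "wavelet \<alpha> \<phi> a x y = wavelet \<alpha> \<phi> a y x"
  unfolding wavelet_def gen_translation_def by (simp add: ac_simps)

text \<open>
  Windows are measurable on the half space only, while the argument at which the generalized
  translation evaluates them ranges over the whole space as a function of \<open>a\<close>, \<open>x\<close>, \<open>y\<close> and \<open>\<theta>\<close>.
  Passing to a Borel function on the whole space makes joint measurability a matter of composition.
\<close>

definition zero_extension :: "(('n::finite) point \<Rightarrow> complex) \<Rightarrow> 'n point \<Rightarrow> complex" where
  "zero_extension \<phi> x = indicator half_space x *\<^sub>R \<phi> x"

lemma zero_extension_borel:
  fixes \<phi> :: "('n::finite) point \<Rightarrow> complex"
  assumes "\<phi> \<in> borel_measurable (weinstein_measure \<alpha>)"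
  shows "zero_extension \<phi> \<in> borel_measurable borel"
proof -
  have "\<phi> \<in> borel_measurable (restrict_space borel half_space)"
    using assms by (simp cong: measurable_cong_sets add: sets_weinstein_measure)
  then show ?thesis
    unfolding zero_extension_def by (subst (asm) borel_measurable_restrict_space_iff) simp_all
qed

lemma zero_extension_eq [simp]: "x \<in> half_space \<Longrightarrow> zero_extension \<phi> x = \<phi> x"
  by (simp add: zero_extension_def)

lemma wavelet_zero_extension:
  assumes "x \<in> half_space" "y \<in> half_space" "a > 0"
  shows "wavelet \<alpha> \<phi> a x y = wavelet \<alpha> (zero_extension \<phi>) a x y"
  using assms by (intro wavelet_cong_half_space) simp_all

lemma wavelet_borel_measurable:
  fixes \<phi> :: "('n::finite) point \<Rightarrow> complex"
  assumes [measurable]: "\<phi> \<in> borel_measurable borel"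
    and [measurable]: "A \<in> borel_measurable M" "X \<in> borel_measurable M" "Y \<in> borel_measurable M"
  shows "(\<lambda>p. wavelet \<alpha> \<phi> (A p) (X p) (Y p)) \<in> borel_measurable M"
  unfolding wavelet_def gen_translation_def dilation_def interval_lebesgue_integral_def
    set_lebesgue_integral_def zero_ereal_def
  by simp

lemma wavelet_norm_le:
  fixes \<phi> :: "('n::finite) point \<Rightarrow> complex"
  assumes "\<alpha> > - 1 / 2"
  shows "ennreal (norm (wavelet \<alpha> \<phi> a x y))
    \<le> ennreal (a powr (\<alpha> + 1 + real CARD('n) / 2)) *
        nn_translation \<alpha> x (\<lambda>z. ennreal (norm (dilation \<alpha> a \<phi> z))) y"
  using mult_left_mono[OF gen_translation_norm_le[OF assms, of x "dilation \<alpha> a \<phi>" y],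
      of "ennreal (a powr (\<alpha> + 1 + real CARD('n) / 2))"]
  by (simp add: wavelet_def norm_mult ennreal_mult')

lemma nn_integral_dilation:
  fixes \<phi> :: "('n::finite) point \<Rightarrow> complex"
  assumes [measurable]: "\<phi> \<in> borel_measurable borel" and a: "a > 0"
  shows "(\<integral>\<^sup>+z. ennreal (norm (dilation \<alpha> a \<phi> z)) \<partial>weinstein_measure \<alpha>)
    = (\<integral>\<^sup>+z. ennreal (norm (\<phi> z)) \<partial>weinstein_measure \<alpha>)"
proof -
  have [measurable]: "(\<lambda>z. ennreal (norm (\<phi> (z /\<^sub>R a)))) \<in> borel_measurable (weinstein_measure \<alpha>)"
    by (subst measurable_cong_sets[OF sets_weinstein_measure refl], rule measurable_restrict_space1) simp
  have "(\<integral>\<^sup>+z. ennreal (norm (dilation \<alpha> a \<phi> z)) \<partial>weinstein_measure \<alpha>)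
    = (\<integral>\<^sup>+z. ennreal (a powr (- (2 * \<alpha> + real CARD('n) + 2))) * ennreal (norm (\<phi> (z /\<^sub>R a)))
        \<partial>weinstein_measure \<alpha>)"
    by (simp add: dilation_def norm_mult ennreal_mult')
  also have "\<dots> = ennreal (a powr (- (2 * \<alpha> + real CARD('n) + 2))) *
      (\<integral>\<^sup>+z. ennreal (norm (\<phi> (z /\<^sub>R a))) \<partial>weinstein_measure \<alpha>)"
    by (rule nn_integral_cmult) measurable
  also have "\<dots> = (\<integral>\<^sup>+z. ennreal (norm (\<phi> z)) \<partial>weinstein_measure \<alpha>)"
    using a by (subst nn_integral_weinstein_measure_dilation)
      (simp_all add: mult.assoc[symmetric] ennreal_mult'[symmetric] powr_add[symmetric])
  finally show ?thesis .
qed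

text \<open>
  Dilation and translation both preserve the \<open>L\<^sup>1\<close> norm, so only the normalizing power of \<open>a\<close> remains.
\<close>

lemma nn_integral_wavelet_le:
  fixes \<phi> :: "('n::finite) point \<Rightarrow> complex"
  assumes \<alpha>: "\<alpha> > - 1 / 2" and \<phi>: "\<phi> \<in> borel_measurable (weinstein_measure \<alpha>)"
    and a: "a > 0" and x: "x \<in> half_space"
  shows "(\<integral>\<^sup>+y. ennreal (norm (wavelet \<alpha> \<phi> a x y)) \<partial>weinstein_measure \<alpha>)
    \<le> ennreal (a powr (\<alpha> + 1 + real CARD('n) / 2)) * (\<integral>\<^sup>+y. ennreal (norm (\<phi> y)) \<partial>weinstein_measure \<alpha>)"
proof -
  let ?\<phi> = "zero_extension \<phi>"
  let ?g = "\<lambda>z. ennreal (norm (dilation \<alpha> a ?\<phi> z))"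
  have [measurable]: "?\<phi> \<in> borel_measurable borel" using \<phi> by (rule zero_extension_borel)
  have [measurable]: "dilation \<alpha> a ?\<phi> \<in> borel_measurable borel"
    unfolding dilation_def[abs_def] by measurable
  have [measurable]: "nn_translation \<alpha> x ?g \<in> borel_measurable (weinstein_measure \<alpha>)"
    by (subst measurable_cong_sets[OF sets_weinstein_measure refl], rule measurable_restrict_space1) simp
  have "(\<integral>\<^sup>+y. ennreal (norm (wavelet \<alpha> \<phi> a x y)) \<partial>weinstein_measure \<alpha>)
    = (\<integral>\<^sup>+y. ennreal (norm (wavelet \<alpha> ?\<phi> a x y)) \<partial>weinstein_measure \<alpha>)"
    using a x by (intro nn_integral_cong) (simp add: wavelet_zero_extension[of _ _ _ _ \<phi>])
  also have "\<dots> \<le> (\<integral>\<^sup>+y. ennreal (a powr (\<alpha> + 1 + real CARD('n) / 2)) * nn_translation \<alpha> x ?g y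
      \<partial>weinstein_measure \<alpha>)"
    by (intro nn_integral_mono wavelet_norm_le[OF \<alpha>])
  also have "\<dots> = ennreal (a powr (\<alpha> + 1 + real CARD('n) / 2)) *
      (\<integral>\<^sup>+y. nn_translation \<alpha> x ?g y \<partial>weinstein_measure \<alpha>)"
    by (rule nn_integral_cmult) measurable
  also have "(\<integral>\<^sup>+y. nn_translation \<alpha> x ?g y \<partial>weinstein_measure \<alpha>)
      = (\<integral>\<^sup>+y. ennreal (norm (?\<phi> y)) \<partial>weinstein_measure \<alpha>)"
    using a by (subst nn_integral_nn_translation[OF \<alpha>]) (simp_all add: nn_integral_dilation)
  also have "\<dots> = (\<integral>\<^sup>+y. ennreal (norm (\<phi> y)) \<partial>weinstein_measure \<alpha>)"
    by (intro nn_integral_cong) simp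
  finally show ?thesis .
qed

text \<open>
  If \<open>\<psi>\<close> is bounded by \<open>M\<close> off a null set, the dilated function is at most
  \<open>a\<^bsup>-(2\<alpha>+d+2)\<^esup> M + g (z / a)\<close> everywhere, where \<open>g\<close> is \<open>\<infinity>\<close> on the null set and \<open>0\<close> elsewhere.
  The translation of a constant is that constant, and the translation of the second term has integral
  \<open>0\<close>, hence vanishes almost everywhere.
\<close>

lemma AE_wavelet_le:
  fixes \<psi> :: "('n::finite) point \<Rightarrow> complex"
  assumes \<alpha>: "\<alpha> > - 1 / 2" and \<psi>[measurable]: "\<psi> \<in> borel_measurable (weinstein_measure \<alpha>)"
    and a: "a > 0" and x: "x \<in> half_space"
    and M: "M \<ge> 0" "AE z in weinstein_measure \<alpha>. norm (\<psi> z) \<le> M"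
  shows "AE y in weinstein_measure \<alpha>.
    norm (wavelet \<alpha> \<psi> a x y) \<le> a powr (- (\<alpha> + 1 + real CARD('n) / 2)) * M"
proof -
  let ?\<psi> = "zero_extension \<psi>"
  define A where "A = a powr (- (2 * \<alpha> + real CARD('n) + 2))"
  define g :: "'n point \<Rightarrow> ennreal" where "g z = \<infinity> * indicator {z. M < norm (?\<psi> z)} z" for z
  have [measurable]: "?\<psi> \<in> borel_measurable borel" using \<psi> by (rule zero_extension_borel)
  have g[measurable]: "g \<in> borel_measurable borel" unfolding g_def by measurable
  have [measurable]: "nn_translation \<alpha> x (\<lambda>z. g (z /\<^sub>R a)) \<in> borel_measurable (weinstein_measure \<alpha>)"
    by (subst measurable_cong_sets[OF sets_weinstein_measure refl], rule measurable_restrict_space1) simp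
  have "(\<integral>\<^sup>+z. g z \<partial>weinstein_measure \<alpha>) = integral\<^sup>N (weinstein_measure \<alpha>) (\<lambda>_ :: 'n point. 0)"
  proof (rule nn_integral_cong_AE)
    show "AE z in weinstein_measure \<alpha>. g z = 0"
      using M(2) AE_space by eventually_elim (simp add: g_def)
  qed
  then have "(\<integral>\<^sup>+y. nn_translation \<alpha> x (\<lambda>z. g (z /\<^sub>R a)) y \<partial>weinstein_measure \<alpha>) = 0"
    using a by (simp add: nn_integral_nn_translation[OF \<alpha>] nn_integral_weinstein_measure_dilation)
  then have "AE y in weinstein_measure \<alpha>. nn_translation \<alpha> x (\<lambda>z. g (z /\<^sub>R a)) y = 0"
    by (subst (asm) nn_integral_0_iff_AE) simp_all
  then show ?thesis
    using AE_space
  proof eventually_elim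
    case (elim y)
    have le: "ennreal (norm (dilation \<alpha> a ?\<psi> z)) \<le> ennreal (A * M) + g (z /\<^sub>R a)" for z
      by (cases "M < norm (?\<psi> (z /\<^sub>R a))")
         (auto simp: g_def dilation_def norm_mult A_def intro!: mult_left_mono ennreal_leI)
    have "ennreal (norm (wavelet \<alpha> \<psi> a x y)) = ennreal (norm (wavelet \<alpha> ?\<psi> a x y))"
      using a x elim by (simp add: wavelet_zero_extension[of _ _ _ _ \<psi>])
    also have "\<dots> \<le> ennreal (a powr (\<alpha> + 1 + real CARD('n) / 2)) *
        nn_translation \<alpha> x (\<lambda>z. ennreal (norm (dilation \<alpha> a ?\<psi> z))) y"
      by (rule wavelet_norm_le[OF \<alpha>])
    also have "\<dots> \<le> ennreal (a powr (\<alpha> + 1 + real CARD('n) / 2)) *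
        nn_translation \<alpha> x (\<lambda>z. ennreal (A * M) + g (z /\<^sub>R a)) y"
      by (intro mult_left_mono nn_translation_mono le) simp
    also have "nn_translation \<alpha> x (\<lambda>z. ennreal (A * M) + g (z /\<^sub>R a)) y = ennreal (A * M)"
      using elim by (simp add: nn_translation_add nn_translation_const[OF \<alpha>])
    also have "ennreal (a powr (\<alpha> + 1 + real CARD('n) / 2)) * ennreal (A * M)
      = ennreal ((a powr (\<alpha> + 1 + real CARD('n) / 2) * A) * M)"
      by (simp add: ennreal_mult'[symmetric] mult.assoc)
    also have "a powr (\<alpha> + 1 + real CARD('n) / 2) * A = a powr (- (\<alpha> + 1 + real CARD('n) / 2))"
      unfolding A_def powr_add[symmetric] by (rule arg_cong[where f = "\<lambda>e. a powr e"]) simp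
    finally show ?case using M(1) by (subst (asm) ennreal_le_iff) auto
  qed
qed

section \<open>Measures on the half space and on the wavelet parameters\<close>

lemma sigma_finite_weinstein_measure:
  "sigma_finite_measure (weinstein_measure \<alpha> :: ('n::finite) point measure)"
proof -
  have [measurable]: "(snd :: 'n point \<Rightarrow> real) \<in> borel_measurable (restrict_space lborel half_space)"
    by (rule measurable_restrict_space1) simp
  interpret sigma_finite_measure "restrict_space lborel half_space :: 'n point measure"
    by (rule sigma_finite_measure_restrict_space[OF sigma_finite_lborel]) simp
  show ?thesis
    unfolding weinstein_measure_def by (subst sigma_finite_iff_density_finite) auto
qed

lemma sigma_finite_positive_halfline: "sigma_finite_measure (restrict_space lborel {0::real<..})"
  by (rule sigma_finite_measure_restrict_space[OF sigma_finite_lborel]) simp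

lemma measurable_ident_subspace:
  "(\<lambda>a. a) \<in> borel_measurable (restrict_space lborel {0::real<..})"
  "(\<lambda>y. y) \<in> borel_measurable (weinstein_measure \<alpha> :: ('n::finite) point measure)"
  by (rule measurable_restrict_space1, simp)
     (subst measurable_cong_sets[OF sets_weinstein_measure refl], rule measurable_restrict_space1, simp)

lemma sets_wavelet_measure [measurable_cong]:
  "sets (wavelet_measure \<alpha> :: (real \<times> ('n::finite) point) measure)
    = sets (restrict_space lborel {0<..} \<Otimes>\<^sub>M weinstein_measure \<alpha>)"
  by (simp add: wavelet_measure_def)

lemma space_wavelet_measure:
  "space (wavelet_measure \<alpha> :: (real \<times> ('n::finite) point) measure) = {0<..} \<times> half_space"
  by (simp add: wavelet_measure_def space_pair_measure space_restrict_space)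

lemma measurable_wavelet_measure_coordinates:
  "fst \<in> borel_measurable (wavelet_measure \<alpha> :: (real \<times> ('n::finite) point) measure)"
  "snd \<in> borel_measurable (wavelet_measure \<alpha> :: (real \<times> ('n::finite) point) measure)"
  using measurable_compose[OF measurable_fst measurable_ident_subspace(1)]
    measurable_compose[OF measurable_snd measurable_ident_subspace(2)]
  by (simp_all add: measurable_cong_sets[OF sets_wavelet_measure refl])

lemma wavelet_density_measurable:
  "(\<lambda>(a, x). ennreal (1 / a powr (2 * \<alpha> + real CARD('n) + 3)))
    \<in> borel_measurable (restrict_space lborel {0<..} \<Otimes>\<^sub>M (weinstein_measure \<alpha> :: ('n::finite) point measure))"
proof -
  have [measurable]: "fst \<in> borel_measurable
      (restrict_space lborel {0::real<..} \<Otimes>\<^sub>M (weinstein_measure \<alpha> :: 'n point measure))"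
    by (rule measurable_compose[OF measurable_fst measurable_ident_subspace(1)])
  show ?thesis unfolding case_prod_beta by measurable
qed

lemma sigma_finite_wavelet_measure:
  "sigma_finite_measure (wavelet_measure \<alpha> :: (real \<times> ('n::finite) point) measure)"
proof -
  interpret pair_sigma_finite "restrict_space lborel {0::real<..}" "weinstein_measure \<alpha> :: 'n point measure"
    by (intro pair_sigma_finite.intro sigma_finite_weinstein_measure sigma_finite_positive_halfline)
  show ?thesis
    unfolding wavelet_measure_def
    by (subst P.sigma_finite_iff_density_finite)
       (use wavelet_density_measurable in \<open>auto simp: case_prod_beta\<close>)
qed

text \<open>
  By Tonelli, a measurable property that holds for every scale \<open>a\<close> and almost every position \<open>x\<close>
  holds almost everywhere for the wavelet measure.
\<close>

lemma AE_wavelet_measureI: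
  fixes P :: "real \<Rightarrow> ('n::finite) point \<Rightarrow> bool"
  assumes P: "{p \<in> space (wavelet_measure \<alpha>). P (fst p) (snd p)}
      \<in> sets (wavelet_measure \<alpha> :: (real \<times> 'n point) measure)"
    and ae: "\<And>a. a > 0 \<Longrightarrow> AE x in weinstein_measure \<alpha>. P a x"
  shows "AE p in wavelet_measure \<alpha>. P (fst p) (snd p)"
proof -
  interpret pair_sigma_finite "restrict_space lborel {0::real<..}" "weinstein_measure \<alpha> :: 'n point measure"
    by (intro pair_sigma_finite.intro sigma_finite_weinstein_measure sigma_finite_positive_halfline)
  have "AE p in restrict_space lborel {0<..} \<Otimes>\<^sub>M weinstein_measure \<alpha>. P (fst p) (snd p)"
  proof (rule AE_pair_measure)
    show "{p \<in> space (restrict_space lborel {0<..} \<Otimes>\<^sub>M weinstein_measure \<alpha>). P (fst p) (snd p)}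
      \<in> sets (restrict_space lborel {0<..} \<Otimes>\<^sub>M weinstein_measure \<alpha>)"
      using P by (simp add: wavelet_measure_def)
    show "AE a in restrict_space lborel {0<..}. AE x in weinstein_measure \<alpha>. P (fst (a, x)) (snd (a, x))"
      by (rule AE_I2) (simp add: ae space_restrict_space)
  qed
  then show ?thesis
    unfolding wavelet_measure_def
    by (subst AE_density[OF wavelet_density_measurable]) (erule eventually_mono, simp)
qed

section \<open>The essential supremum norm\<close>

lemma Linf_space_measurable: "f \<in> Linf_space M \<Longrightarrow> f \<in> borel_measurable M"
  by (simp add: Linf_space_def)

lemma Linf_norm_nonneg: "0 \<le> Linf_norm M f"
  by (simp add: Linf_norm_def)

lemma AE_le_Linf_norm:
  assumes "f \<in> Linf_space M"
  shows "AE x in M. norm (f x) \<le> Linf_norm M f"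
proof -
  have eq: "esssup M (\<lambda>x. ennreal (norm (f x))) = ennreal (Linf_norm M f)"
    using assms by (simp add: Linf_space_def Linf_norm_def)
  show ?thesis
    using esssup_AE[of "\<lambda>x. ennreal (norm (f x))" M] unfolding eq
    by eventually_elim (simp add: Linf_norm_nonneg)
qed

lemma Linf_bounded_function:
  assumes [measurable]: "f \<in> borel_measurable M" and C: "C \<ge> 0" "\<And>x. x \<in> space M \<Longrightarrow> norm (f x) \<le> C"
  shows "f \<in> Linf_space M" "Linf_norm M f \<le> C"
proof -
  have le: "esssup M (\<lambda>x. ennreal (norm (f x))) \<le> ennreal C"
    by (intro esssup_I AE_I2 ennreal_leI C(2)) measurable
  then show "f \<in> Linf_space M"
    using le_less_trans[OF le ennreal_less_top] by (simp add: Linf_space_def)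
  show "Linf_norm M f \<le> C"
    unfolding Linf_norm_def using enn2real_mono[OF le] C(1) by simp
qed

section \<open>The wavelet transform of an essentially bounded function\<close>

lemma integrable_wavelet:
  fixes \<phi> :: "('n::finite) point \<Rightarrow> complex"
  assumes \<alpha>: "\<alpha> > - 1 / 2" and \<phi>: "integrable (weinstein_measure \<alpha>) \<phi>"
    and a: "a > 0" and x: "x \<in> half_space"
  shows "integrable (weinstein_measure \<alpha>) (wavelet \<alpha> \<phi> a x)"
    and "(LINT y|weinstein_measure \<alpha>. norm (wavelet \<alpha> \<phi> a x y))
      \<le> a powr (\<alpha> + 1 + real CARD('n) / 2) * L1_norm (weinstein_measure \<alpha>) \<phi>"
proof -
  have meas[measurable]: "\<phi> \<in> borel_measurable (weinstein_measure \<alpha>)" using \<phi> by simp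
  have "(\<integral>\<^sup>+y. ennreal (norm (\<phi> y)) \<partial>weinstein_measure \<alpha>) = ennreal (L1_norm (weinstein_measure \<alpha>) \<phi>)"
    unfolding L1_norm_def using \<phi> by (intro nn_integral_eq_integral) auto
  then have le: "(\<integral>\<^sup>+y. ennreal (norm (wavelet \<alpha> \<phi> a x y)) \<partial>weinstein_measure \<alpha>)
    \<le> ennreal (a powr (\<alpha> + 1 + real CARD('n) / 2) * L1_norm (weinstein_measure \<alpha>) \<phi>)"
    using nn_integral_wavelet_le[OF \<alpha> meas a x] by (simp add: ennreal_mult')
  have "(\<lambda>y. wavelet \<alpha> (zero_extension \<phi>) a x y) \<in> borel_measurable (weinstein_measure \<alpha>)"
    by (intro wavelet_borel_measurable zero_extension_borel[OF meas] measurable_ident_subspace) simp_all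
  then have W: "wavelet \<alpha> \<phi> a x \<in> borel_measurable (weinstein_measure \<alpha>)"
    by (rule measurable_cong[THEN iffD1, rotated]) (use a x wavelet_zero_extension[of x _ a \<alpha> \<phi>] in simp)
  show int: "integrable (weinstein_measure \<alpha>) (wavelet \<alpha> \<phi> a x)"
    using W le_less_trans[OF le ennreal_less_top] by (intro integrableI_bounded) simp_all
  have "ennreal (LINT y|weinstein_measure \<alpha>. norm (wavelet \<alpha> \<phi> a x y))
    = (\<integral>\<^sup>+y. ennreal (norm (wavelet \<alpha> \<phi> a x y)) \<partial>weinstein_measure \<alpha>)"
    using int by (intro nn_integral_eq_integral[symmetric]) auto
  with le have "ennreal (LINT y|weinstein_measure \<alpha>. norm (wavelet \<alpha> \<phi> a x y))
      \<le> ennreal (a powr (\<alpha> + 1 + real CARD('n) / 2) * L1_norm (weinstein_measure \<alpha>) \<phi>)"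
    by simp
  then show "(LINT y|weinstein_measure \<alpha>. norm (wavelet \<alpha> \<phi> a x y))
      \<le> a powr (\<alpha> + 1 + real CARD('n) / 2) * L1_norm (weinstein_measure \<alpha>) \<phi>"
    by (subst (asm) ennreal_le_iff) (simp_all add: L1_norm_def)
qed

text \<open>
  Hoelder's inequality for the exponents \<open>\<infinity>\<close> and \<open>1\<close>.  The growth \<open>a\<^bsup>\<alpha>+1+d/2\<^esup>\<close> is compensated by
  the decay of the wavelet of \<open>\<psi>\<close> in \<open>AE_wavelet_le\<close>.
\<close>

lemma wavelet_transform_bounded:
  fixes \<phi> :: "('n::finite) point \<Rightarrow> complex"
  assumes \<alpha>: "\<alpha> > - 1 / 2" and \<phi>: "integrable (weinstein_measure \<alpha>) \<phi>"
    and f: "f \<in> Linf_space (weinstein_measure \<alpha>)" and a: "a > 0" and x: "x \<in> half_space"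
  shows "integrable (weinstein_measure \<alpha>) (\<lambda>y. f y * cnj (wavelet \<alpha> \<phi> a x y))"
    and "norm (wavelet_transform \<alpha> \<phi> f (a, x))
      \<le> Linf_norm (weinstein_measure \<alpha>) f *
        (a powr (\<alpha> + 1 + real CARD('n) / 2) * L1_norm (weinstein_measure \<alpha>) \<phi>)"
proof -
  note W = integrable_wavelet[OF \<alpha> \<phi> a x]
  have [measurable]: "f \<in> borel_measurable (weinstein_measure \<alpha>)"
      "wavelet \<alpha> \<phi> a x \<in> borel_measurable (weinstein_measure \<alpha>)"
    using f W(1) by (auto simp: Linf_space_measurable)
  have bound: "AE y in weinstein_measure \<alpha>. norm (f y * cnj (wavelet \<alpha> \<phi> a x y))
      \<le> Linf_norm (weinstein_measure \<alpha>) f * norm (wavelet \<alpha> \<phi> a x y)"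
    using AE_le_Linf_norm[OF f] by eventually_elim (auto simp: norm_mult intro: mult_right_mono)
  have dom: "integrable (weinstein_measure \<alpha>)
      (\<lambda>y. Linf_norm (weinstein_measure \<alpha>) f * norm (wavelet \<alpha> \<phi> a x y))"
    using W(1) by simp
  have cnj: "(\<lambda>y. f y * cnj (wavelet \<alpha> \<phi> a x y)) \<in> borel_measurable (weinstein_measure \<alpha>)"
    by (intro borel_measurable_times borel_measurable_continuous_on[of cnj] continuous_intros) measurable
  show int: "integrable (weinstein_measure \<alpha>) (\<lambda>y. f y * cnj (wavelet \<alpha> \<phi> a x y))"
    by (rule Bochner_Integration.integrable_bound[OF dom cnj])
       (use bound in \<open>auto elim!: eventually_mono simp: Linf_norm_nonneg\<close>)
  have "norm (wavelet_transform \<alpha> \<phi> f (a, x))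
      \<le> (LINT y|weinstein_measure \<alpha>. norm (f y * cnj (wavelet \<alpha> \<phi> a x y)))"
    unfolding wavelet_transform_def by simp
  also have "\<dots> \<le> (LINT y|weinstein_measure \<alpha>. Linf_norm (weinstein_measure \<alpha>) f * norm (wavelet \<alpha> \<phi> a x y))"
    using integrable_norm[OF int] dom bound by (rule integral_mono_AE)
  also have "\<dots> \<le> Linf_norm (weinstein_measure \<alpha>) f *
        (a powr (\<alpha> + 1 + real CARD('n) / 2) * L1_norm (weinstein_measure \<alpha>) \<phi>)"
    using W(2) by (simp add: mult_left_mono Linf_norm_nonneg)
  finally show "norm (wavelet_transform \<alpha> \<phi> f (a, x))
      \<le> Linf_norm (weinstein_measure \<alpha>) f *
        (a powr (\<alpha> + 1 + real CARD('n) / 2) * L1_norm (weinstein_measure \<alpha>) \<phi>)" .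
qed

lemma wavelet_transform_measurable:
  fixes \<phi> :: "('n::finite) point \<Rightarrow> complex"
  assumes \<phi>: "\<phi> \<in> borel_measurable (weinstein_measure \<alpha>)"
    and [measurable]: "f \<in> borel_measurable (weinstein_measure \<alpha>)"
  shows "wavelet_transform \<alpha> \<phi> f \<in> borel_measurable (wavelet_measure \<alpha>)"
proof -
  interpret sigma_finite_measure "weinstein_measure \<alpha> :: 'n point measure"
    by (rule sigma_finite_weinstein_measure)
  have [measurable]: "(\<lambda>q. wavelet \<alpha> (zero_extension \<phi>) (fst (fst q)) (snd (fst q)) (snd q))
      \<in> borel_measurable (wavelet_measure \<alpha> \<Otimes>\<^sub>M weinstein_measure \<alpha>)"
    by (intro wavelet_borel_measurable zero_extension_borel[OF \<phi>]
        measurable_compose[OF measurable_fst measurable_wavelet_measure_coordinates(1)]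
        measurable_compose[OF measurable_fst measurable_wavelet_measure_coordinates(2)]
        measurable_compose[OF measurable_snd measurable_ident_subspace(2)])
  have "(\<lambda>q. f (snd q) * cnj (wavelet \<alpha> (zero_extension \<phi>) (fst (fst q)) (snd (fst q)) (snd q)))
      \<in> borel_measurable (wavelet_measure \<alpha> \<Otimes>\<^sub>M weinstein_measure \<alpha>)"
    by (intro borel_measurable_times borel_measurable_continuous_on[of cnj] continuous_intros) measurable
  then have "(\<lambda>p. LINT y|weinstein_measure \<alpha>. f y * cnj (wavelet \<alpha> (zero_extension \<phi>) (fst p) (snd p) y))
      \<in> borel_measurable (wavelet_measure \<alpha>)"
    by (intro borel_measurable_lebesgue_integral) (simp add: case_prod_beta)
  moreover have "wavelet_transform \<alpha> \<phi> f p
      = (LINT y|weinstein_measure \<alpha>. f y * cnj (wavelet \<alpha> (zero_extension \<phi>) (fst p) (snd p) y))"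
    if "p \<in> space (wavelet_measure \<alpha>)" for p
    using that unfolding wavelet_transform_def case_prod_beta
    by (intro Bochner_Integration.integral_cong)
       (auto simp: space_wavelet_measure wavelet_zero_extension[of _ _ _ _ \<phi>])
  ultimately show ?thesis by (simp cong: measurable_cong)
qed

section \<open>The localization operator\<close>

definition localization_integrand ::
    "real \<Rightarrow> (('n::finite) point \<Rightarrow> complex) \<Rightarrow> ('n point \<Rightarrow> complex) \<Rightarrow>
     (real \<times> 'n point \<Rightarrow> complex) \<Rightarrow> ('n point \<Rightarrow> complex) \<Rightarrow> 'n point \<Rightarrow> real \<times> 'n point \<Rightarrow> complex" where
  "localization_integrand \<alpha> \<phi> \<psi> \<sigma> f y p =
     \<sigma> p * wavelet_transform \<alpha> \<phi> f p * wavelet \<alpha> \<psi> (fst p) (snd p) y"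

lemma localization_integrand_eq:
  "localization_integrand \<alpha> \<phi> \<psi> \<sigma> f y =
    (\<lambda>(a, x). \<sigma> (a, x) * wavelet_transform \<alpha> \<phi> f (a, x) * wavelet \<alpha> \<psi> a x y)"
  by (simp add: fun_eq_iff localization_integrand_def)

lemma localization_op_eq:
  "localization_op \<alpha> \<phi> \<psi> \<sigma> f y = (LINT p|wavelet_measure \<alpha>. localization_integrand \<alpha> \<phi> \<psi> \<sigma> f y p)"
  by (simp add: localization_op_def localization_integrand_eq)

lemma wavelet_transform_add:
  fixes \<phi> :: "('n::finite) point \<Rightarrow> complex"
  assumes "\<alpha> > - 1 / 2" and "integrable (weinstein_measure \<alpha>) \<phi>"
    and "f \<in> Linf_space (weinstein_measure \<alpha>)" "g \<in> Linf_space (weinstein_measure \<alpha>)"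
    and p: "p \<in> space (wavelet_measure \<alpha>)"
  shows "wavelet_transform \<alpha> \<phi> (\<lambda>y. f y + g y) p = wavelet_transform \<alpha> \<phi> f p + wavelet_transform \<alpha> \<phi> g p"
  using p wavelet_transform_bounded(1)[OF assms(1,2,3), of "fst p" "snd p"]
    wavelet_transform_bounded(1)[OF assms(1,2,4), of "fst p" "snd p"]
  by (auto simp: wavelet_transform_def space_wavelet_measure distrib_right)

lemma wavelet_transform_cmult:
  "wavelet_transform \<alpha> \<phi> (\<lambda>y. c * f y) p = c * wavelet_transform \<alpha> \<phi> f p"
  by (simp add: wavelet_transform_def case_prod_beta mult.assoc)

lemma wavelet_transform_cong_AE:
  fixes \<phi> :: "('n::finite) point \<Rightarrow> complex"
  assumes "\<alpha> > - 1 / 2" and "integrable (weinstein_measure \<alpha>) \<phi>"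
    and "f \<in> Linf_space (weinstein_measure \<alpha>)" "g \<in> Linf_space (weinstein_measure \<alpha>)"
    and p: "p \<in> space (wavelet_measure \<alpha>)"
    and "AE y in weinstein_measure \<alpha>. f y = g y"
  shows "wavelet_transform \<alpha> \<phi> f p = wavelet_transform \<alpha> \<phi> g p"
proof -
  have "fst p > 0" "snd p \<in> half_space" using p by (auto simp: space_wavelet_measure)
  then have "(\<lambda>y. f y * cnj (wavelet \<alpha> \<phi> (fst p) (snd p) y)) \<in> borel_measurable (weinstein_measure \<alpha>)"
    "(\<lambda>y. g y * cnj (wavelet \<alpha> \<phi> (fst p) (snd p) y)) \<in> borel_measurable (weinstein_measure \<alpha>)"
    using wavelet_transform_bounded(1)[OF assms(1,2,3)] wavelet_transform_bounded(1)[OF assms(1,2,4)]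
    by (auto intro!: borel_measurable_integrable)
  then show ?thesis
    unfolding wavelet_transform_def case_prod_beta
    by (rule integral_cong_AE) (use assms(6) in \<open>auto elim: eventually_mono\<close>)
qed

lemma localization_integrand_jointly_measurable:
  fixes \<phi> \<psi> :: "('n::finite) point \<Rightarrow> complex"
  assumes \<phi>: "\<phi> \<in> borel_measurable (weinstein_measure \<alpha>)"
    and \<psi>: "\<psi> \<in> borel_measurable (weinstein_measure \<alpha>)"
    and \<sigma>[measurable]: "\<sigma> \<in> borel_measurable (wavelet_measure \<alpha>)"
    and f: "f \<in> borel_measurable (weinstein_measure \<alpha>)"
  shows "(\<lambda>(y, p). localization_integrand \<alpha> \<phi> \<psi> \<sigma> f y p)
    \<in> borel_measurable (weinstein_measure \<alpha> \<Otimes>\<^sub>M wavelet_measure \<alpha>)"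
proof -
  have [measurable]: "wavelet_transform \<alpha> \<phi> f \<in> borel_measurable (wavelet_measure \<alpha>)"
    using \<phi> f by (rule wavelet_transform_measurable)
  have [measurable]: "(\<lambda>q. wavelet \<alpha> (zero_extension \<psi>) (fst (snd q)) (snd (snd q)) (fst q))
      \<in> borel_measurable (weinstein_measure \<alpha> \<Otimes>\<^sub>M wavelet_measure \<alpha>)"
    by (intro wavelet_borel_measurable zero_extension_borel[OF \<psi>]
        measurable_compose[OF measurable_snd measurable_wavelet_measure_coordinates(1)]
        measurable_compose[OF measurable_snd measurable_wavelet_measure_coordinates(2)]
        measurable_compose[OF measurable_fst measurable_ident_subspace(2)])
  have "(\<lambda>q. \<sigma> (snd q) * wavelet_transform \<alpha> \<phi> f (snd q) *
        wavelet \<alpha> (zero_extension \<psi>) (fst (snd q)) (snd (snd q)) (fst q))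
      \<in> borel_measurable (weinstein_measure \<alpha> \<Otimes>\<^sub>M wavelet_measure \<alpha>)"
    by measurable
  moreover have "\<sigma> (snd q) * wavelet_transform \<alpha> \<phi> f (snd q) *
        wavelet \<alpha> (zero_extension \<psi>) (fst (snd q)) (snd (snd q)) (fst q)
      = (case q of (y, p) \<Rightarrow> localization_integrand \<alpha> \<phi> \<psi> \<sigma> f y p)"
    if "q \<in> space (weinstein_measure \<alpha> \<Otimes>\<^sub>M wavelet_measure \<alpha>)" for q
    using that by (auto simp: localization_integrand_def space_pair_measure space_wavelet_measure
        wavelet_zero_extension[of _ _ _ _ \<psi>])
  ultimately show ?thesis by (simp cong: measurable_cong)
qed

text \<open>
  The powers of \<open>a\<close> in the bounds of the wavelet transform and of the wavelet cancel, leaving a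
  multiple of \<open>\<bar>\<sigma>\<bar>\<close>.  The bound holds for every \<open>y\<close>, since the wavelet is symmetric in \<open>x\<close> and \<open>y\<close>:
  its almost-everywhere bound, derived with one position fixed, applies with \<open>y\<close> as the fixed position.
\<close>

lemma AE_localization_integrand_le:
  fixes \<phi> \<psi> :: "('n::finite) point \<Rightarrow> complex"
  assumes \<alpha>: "\<alpha> > - 1 / 2" and \<phi>: "integrable (weinstein_measure \<alpha>) \<phi>"
    and \<psi>: "\<psi> \<in> Linf_space (weinstein_measure \<alpha>)"
    and f: "f \<in> Linf_space (weinstein_measure \<alpha>)" and y: "y \<in> half_space"
  shows "AE p in wavelet_measure \<alpha>. norm (localization_integrand \<alpha> \<phi> \<psi> \<sigma> f y p)
    \<le> L1_norm (weinstein_measure \<alpha>) \<phi> * Linf_norm (weinstein_measure \<alpha>) \<psi> *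
        Linf_norm (weinstein_measure \<alpha>) f * norm (\<sigma> p)"
proof -
  let ?\<psi> = "zero_extension \<psi>"
  define F where "F = Linf_norm (weinstein_measure \<alpha>) f"
  define P where "P = L1_norm (weinstein_measure \<alpha>) \<phi>"
  define S where "S = Linf_norm (weinstein_measure \<alpha>) \<psi>"
  define b where "b = \<alpha> + 1 + real CARD('n) / 2"
  have \<psi>_meas: "\<psi> \<in> borel_measurable (weinstein_measure \<alpha>)"
    using \<psi> by (rule Linf_space_measurable)
  have nonneg: "F \<ge> 0" "P \<ge> 0" "S \<ge> 0"
    by (simp_all add: F_def P_def S_def Linf_norm_nonneg L1_norm_def)
  have "AE p in wavelet_measure \<alpha>. norm (wavelet \<alpha> ?\<psi> (fst p) (snd p) y) \<le> fst p powr (- b) * S"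
  proof (rule AE_wavelet_measureI[where P = "\<lambda>a x. norm (wavelet \<alpha> ?\<psi> a x y) \<le> a powr (- b) * S"])
    have [measurable]: "fst \<in> borel_measurable (wavelet_measure \<alpha> :: (real \<times> 'n point) measure)"
      by (rule measurable_wavelet_measure_coordinates)
    have [measurable]: "(\<lambda>p. wavelet \<alpha> ?\<psi> (fst p) (snd p) y) \<in> borel_measurable (wavelet_measure \<alpha>)"
      by (intro wavelet_borel_measurable zero_extension_borel[OF \<psi>_meas]
          measurable_wavelet_measure_coordinates) simp
    show "{p \<in> space (wavelet_measure \<alpha>). norm (wavelet \<alpha> ?\<psi> (fst p) (snd p) y) \<le> fst p powr (- b) * S}
      \<in> sets (wavelet_measure \<alpha>)"
      by measurable
    show "AE x in weinstein_measure \<alpha>. norm (wavelet \<alpha> ?\<psi> a x y) \<le> a powr (- b) * S" if a: "a > 0" for a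
      using AE_wavelet_le[OF \<alpha> \<psi>_meas a y nonneg(3)[unfolded S_def] AE_le_Linf_norm[OF \<psi>]] AE_space
    proof eventually_elim
      case (elim x)
      have "wavelet \<alpha> ?\<psi> a x y = wavelet \<alpha> \<psi> a y x"
        using elim a y by (simp add: wavelet_commute[of _ _ _ x] wavelet_zero_extension[of _ _ _ _ \<psi>])
      then show ?case using elim by (simp add: b_def S_def)
    qed
  qed
  then show ?thesis
    using AE_space
  proof eventually_elim
    case (elim p)
    then have a: "fst p > 0" and x: "snd p \<in> half_space" by (auto simp: space_wavelet_measure)
    have T: "norm (wavelet_transform \<alpha> \<phi> f p) \<le> F * (fst p powr b * P)"
      using wavelet_transform_bounded(2)[OF \<alpha> \<phi> f a x] by (simp add: F_def P_def b_def)
    have W: "norm (wavelet \<alpha> \<psi> (fst p) (snd p) y) \<le> fst p powr (- b) * S"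
      using elim a x y by (simp add: wavelet_zero_extension[of _ _ _ _ \<psi>])
    have "norm (localization_integrand \<alpha> \<phi> \<psi> \<sigma> f y p)
      = norm (\<sigma> p) * (norm (wavelet_transform \<alpha> \<phi> f p) * norm (wavelet \<alpha> \<psi> (fst p) (snd p) y))"
      by (simp add: localization_integrand_def norm_mult mult.assoc)
    also have "\<dots> \<le> norm (\<sigma> p) * ((F * (fst p powr b * P)) * (fst p powr (- b) * S))"
      using nonneg by (intro mult_left_mono mult_mono T W) auto
    also have "\<dots> = P * S * F * norm (\<sigma> p) * (fst p powr b * fst p powr (- b))"
      by (simp add: mult_ac)
    also have "\<dots> = P * S * F * norm (\<sigma> p)"
      using a by (simp flip: powr_add)
    finally show ?case unfolding F_def P_def S_def .
  qed
qed

lemma localization_op_bounded: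
  fixes \<phi> \<psi> :: "('n::finite) point \<Rightarrow> complex"
  assumes \<alpha>: "\<alpha> > - 1 / 2" and \<sigma>: "integrable (wavelet_measure \<alpha>) \<sigma>"
    and \<phi>: "integrable (weinstein_measure \<alpha>) \<phi>"
    and \<psi>: "\<psi> \<in> Linf_space (weinstein_measure \<alpha>)"
    and f: "f \<in> Linf_space (weinstein_measure \<alpha>)" and y: "y \<in> half_space"
  shows "integrable (wavelet_measure \<alpha>) (localization_integrand \<alpha> \<phi> \<psi> \<sigma> f y)"
    and "norm (localization_op \<alpha> \<phi> \<psi> \<sigma> f y)
      \<le> L1_norm (weinstein_measure \<alpha>) \<phi> * Linf_norm (weinstein_measure \<alpha>) \<psi> *
        L1_norm (wavelet_measure \<alpha>) \<sigma> * Linf_norm (weinstein_measure \<alpha>) f"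
proof -
  define K where "K = L1_norm (weinstein_measure \<alpha>) \<phi> * Linf_norm (weinstein_measure \<alpha>) \<psi> *
        Linf_norm (weinstein_measure \<alpha>) f"
  have bound: "AE p in wavelet_measure \<alpha>. norm (localization_integrand \<alpha> \<phi> \<psi> \<sigma> f y p) \<le> K * norm (\<sigma> p)"
    unfolding K_def by (rule AE_localization_integrand_le[OF \<alpha> \<phi> \<psi> f y])
  have dom: "integrable (wavelet_measure \<alpha>) (\<lambda>p. K * norm (\<sigma> p))"
    using \<sigma> by simp
  have "(\<lambda>(y, p). localization_integrand \<alpha> \<phi> \<psi> \<sigma> f y p)
      \<in> borel_measurable (weinstein_measure \<alpha> \<Otimes>\<^sub>M wavelet_measure \<alpha>)"
    using \<sigma> \<phi> \<psi> f by (intro localization_integrand_jointly_measurable) (auto simp: Linf_space_measurable)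
  from measurable_Pair2[OF this, of y] y
  have meas: "localization_integrand \<alpha> \<phi> \<psi> \<sigma> f y \<in> borel_measurable (wavelet_measure \<alpha>)"
    by simp
  show int: "integrable (wavelet_measure \<alpha>) (localization_integrand \<alpha> \<phi> \<psi> \<sigma> f y)"
    by (rule Bochner_Integration.integrable_bound[OF dom meas])
       (use bound in eventually_elim, simp)
  have "norm (localization_op \<alpha> \<phi> \<psi> \<sigma> f y)
    \<le> (LINT p|wavelet_measure \<alpha>. norm (localization_integrand \<alpha> \<phi> \<psi> \<sigma> f y p))"
    unfolding localization_op_eq by simp
  also have "\<dots> \<le> (LINT p|wavelet_measure \<alpha>. K * norm (\<sigma> p))"
    using integrable_norm[OF int] dom bound by (rule integral_mono_AE)
  also have "\<dots> = L1_norm (weinstein_measure \<alpha>) \<phi> * Linf_norm (weinstein_measure \<alpha>) \<psi> *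
        L1_norm (wavelet_measure \<alpha>) \<sigma> * Linf_norm (weinstein_measure \<alpha>) f"
    by (simp add: K_def L1_norm_def mult_ac)
  finally show "norm (localization_op \<alpha> \<phi> \<psi> \<sigma> f y)
      \<le> L1_norm (weinstein_measure \<alpha>) \<phi> * Linf_norm (weinstein_measure \<alpha>) \<psi> *
        L1_norm (wavelet_measure \<alpha>) \<sigma> * Linf_norm (weinstein_measure \<alpha>) f" .
qed

theorem proposition3p4:
  fixes \<alpha> :: real
    and \<phi> \<psi> :: "('n::finite) point \<Rightarrow> complex"
    and \<sigma> :: "real \<times> 'n point \<Rightarrow> complex"
  assumes "\<alpha> > - 1 / 2"
    and "integrable (wavelet_measure \<alpha>) \<sigma>"
    and "integrable (weinstein_measure \<alpha>) \<phi>"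
    and "\<psi> \<in> Linf_space (weinstein_measure \<alpha>)"
  shows "(\<forall>f \<in> Linf_space (weinstein_measure \<alpha>). localization_op_converges \<alpha> \<phi> \<psi> \<sigma> f) \<and>
    bounded_linear_Linf (weinstein_measure \<alpha>) (localization_op \<alpha> \<phi> \<psi> \<sigma>) \<and>
    Linf_opnorm (weinstein_measure \<alpha>) (localization_op \<alpha> \<phi> \<psi> \<sigma>)
      \<le> L1_norm (weinstein_measure \<alpha>) \<phi> * Linf_norm (weinstein_measure \<alpha>) \<psi> *
        L1_norm (wavelet_measure \<alpha>) \<sigma>"
proof -
  let ?M = "weinstein_measure \<alpha> :: 'n point measure"
  let ?L = "localization_op \<alpha> \<phi> \<psi> \<sigma>"
  define C where "C = L1_norm ?M \<phi> * Linf_norm ?M \<psi> * L1_norm (wavelet_measure \<alpha>) \<sigma>"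
  have C: "C \<ge> 0"
    unfolding C_def by (intro mult_nonneg_nonneg) (simp_all add: L1_norm_def Linf_norm_nonneg)
  note int = localization_op_bounded(1)[OF assms]
  have pointwise: "norm (?L f y) \<le> C * Linf_norm ?M f" if "f \<in> Linf_space ?M" "y \<in> half_space" for f y
    unfolding C_def using that by (rule localization_op_bounded(2)[OF assms])
  have "?L f \<in> borel_measurable ?M" if f: "f \<in> Linf_space ?M" for f
  proof -
    interpret sigma_finite_measure "wavelet_measure \<alpha> :: (real \<times> 'n point) measure"
      by (rule sigma_finite_wavelet_measure)
    have "(\<lambda>(y, p). localization_integrand \<alpha> \<phi> \<psi> \<sigma> f y p) \<in> borel_measurable (?M \<Otimes>\<^sub>M wavelet_measure \<alpha>)"
      using assms f by (intro localization_integrand_jointly_measurable) (auto simp: Linf_space_measurable)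
    then have "(\<lambda>y. LINT p|wavelet_measure \<alpha>. localization_integrand \<alpha> \<phi> \<psi> \<sigma> f y p) \<in> borel_measurable ?M"
      by (rule borel_measurable_lebesgue_integral)
    then show ?thesis unfolding localization_op_eq[abs_def] .
  qed
  note Linf = Linf_bounded_function[OF this]
  have into: "?L f \<in> Linf_space ?M" and bound: "Linf_norm ?M (?L f) \<le> C * Linf_norm ?M f"
    if f: "f \<in> Linf_space ?M" for f
    using Linf[OF f, of "C * Linf_norm ?M f"] pointwise[OF f] C
    by (simp_all add: Linf_norm_nonneg)
  have converges: "localization_op_converges \<alpha> \<phi> \<psi> \<sigma> f" if f: "f \<in> Linf_space ?M" for f
    unfolding localization_op_converges_def
  proof (intro conjI allI impI ballI)
    show "integrable ?M (\<lambda>y. f y * cnj (wavelet \<alpha> \<phi> a x y))" if "a > 0" "x \<in> half_space" for a x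
      using that by (rule wavelet_transform_bounded(1)[OF assms(1,3) f])
    show "AE y in ?M. integrable (wavelet_measure \<alpha>)
        (\<lambda>(a, x). \<sigma> (a, x) * wavelet_transform \<alpha> \<phi> f (a, x) * wavelet \<alpha> \<psi> a x y)"
      using int[OF f] by (intro AE_I2) (simp add: localization_integrand_eq)
  qed
  have cong: "?L f y = ?L g y"
    if "f \<in> Linf_space ?M" "g \<in> Linf_space ?M" "AE x in ?M. f x = g x" for f g y
    unfolding localization_op_eq localization_integrand_def
    by (intro Bochner_Integration.integral_cong refl)
       (simp add: wavelet_transform_cong_AE[OF assms(1,3) that(1,2) _ that(3)])
  have add: "?L (\<lambda>y. f y + g y) y = ?L f y + ?L g y"
    if f: "f \<in> Linf_space ?M" and g: "g \<in> Linf_space ?M" and y: "y \<in> half_space" for f g y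
  proof -
    have "?L (\<lambda>y. f y + g y) y = (LINT p|wavelet_measure \<alpha>.
        localization_integrand \<alpha> \<phi> \<psi> \<sigma> f y p + localization_integrand \<alpha> \<phi> \<psi> \<sigma> g y p)"
      unfolding localization_op_eq localization_integrand_def
      by (intro Bochner_Integration.integral_cong refl)
         (simp add: wavelet_transform_add[OF assms(1,3) f g] algebra_simps)
    also have "\<dots> = ?L f y + ?L g y"
      unfolding localization_op_eq using int[OF f y] int[OF g y]
      by (rule Bochner_Integration.integral_add)
    finally show ?thesis .
  qed
  have cmult: "?L (\<lambda>y. c * f y) y = c * ?L f y" for c f y
  proof -
    have "?L (\<lambda>y. c * f y) y = (LINT p|wavelet_measure \<alpha>. c * localization_integrand \<alpha> \<phi> \<psi> \<sigma> f y p)"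
      by (simp add: localization_op_eq localization_integrand_def wavelet_transform_cmult mult_ac)
    then show ?thesis by (simp add: localization_op_eq)
  qed
  have "bounded_linear_Linf ?M ?L"
    unfolding bounded_linear_Linf_def
    using into bound by (intro conjI ballI allI impI AE_I2 exI[of _ C]) (auto intro: cong add cmult)
  moreover have "Linf_opnorm ?M ?L \<le> C"
    unfolding Linf_opnorm_def
  proof (rule cSUP_least)
    have "(\<lambda>_. 0) \<in> Linf_space ?M" "Linf_norm ?M (\<lambda>_. 0) \<le> 1"
      using Linf_bounded_function[of "\<lambda>_. 0" ?M 1] by simp_all
    then show "{f \<in> Linf_space ?M. Linf_norm ?M f \<le> 1} \<noteq> {}" by blast
    fix f assume "f \<in> {f \<in> Linf_space ?M. Linf_norm ?M f \<le> 1}"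
    then show "Linf_norm ?M (?L f) \<le> C"
      using bound[of f] mult_left_mono[of "Linf_norm ?M f" 1 C] C by auto
  qed
  ultimately show ?thesis
    using converges unfolding C_def by blast
qed

end
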